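(* Assume the standing setting below with a bounded continuous loss function $w:\Theta\times U\to[0,\infty)$. Then $$\inf_{M\in\mathrm{Povm}(U)}\sup_{\theta\in\Theta}R_M(\theta)=\sup_{\pi\in\mathcal{P}(\Theta)}\inf_{M\in\mathrm{Povm}(U)}\int_\Theta R_M(\theta)\,\pi(d\theta).$$
   Context: Standing setting. $\mathcal{H}$ is a complex Hilbert space and $L_1(\mathcal{H})$ the trace-class operators on it; for self-adjoint operators $A\ge B$ means $A-B$ is positive. $\Theta$ and $U$ are compact metric spaces ($d$ the metric on $\Theta$); $C(\Theta)$ is the space of real continuous functions on $\Theta$ with the supremum norm. For compact $K\subseteq\Theta$ and $\delta>0$ let $K_\delta:=\{(\theta,\eta)\in K\times K: d(\theta,\eta)<\delta\}$. For $T:\Theta\to L_1(\mathcal{H})$ with self-adjoint values, $\omega_T(K_\delta):=\inf\{\|X\|_1: X\in L_1(\mathcal{H}),\ -X\le T(\theta)-T(\eta)\le X\ \forall(\theta,\eta)\in K_\delta\}$ (infimum of the empty set is $+\infty$), and $T$ is called regular if $\lim_{\delta\to0}\omega_T(K_\delta)=0$ for every compact $K\subseteq\Theta$. A quantum statistical model is a map $\rho:\Theta\to L_1(\mathcal{H})$ with $\rho(\theta)\ge0$, $\mathrm{Tr}\,\rho(\theta)=1$, which is injective (identifiability) and regular. A POVM on $U$ is a map $M$ from the Borel $\sigma$-algebra of $U$ to bounded operators on $\mathcal{H}$ with $M(B)\ge0$, $M(\bigcup_j B_j)=\sum_j M(B_j)$ for pairwise disjoint $B_j$ (series converging in the weak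 operator topology), and $M(U)=I$; $\mathrm{Povm}(U)$ is the set of all POVMs. For a positive trace-class $T$ and $M\in\mathrm{Povm}(U)$ let $\mu_{T,M}(A):=\mathrm{Tr}\,T M(A)$ and $\mu_{T,M}[f]:=\int_U f\,d\mu_{T,M}$ for $f\in C(U)$. $\mathrm{Povm}(U)$ carries the topology generated by finite intersections of the sets $\{M'\in\mathrm{Povm}(U): |\mu_{T,M}[f]-\mu_{T,M'}[f]|<\epsilon\}$, $\epsilon>0$, $T\ge0$ trace-class, $f\in C(U)$. A loss function is a lower semicontinuous $w:\Theta\times U\to[0,+\infty]$. The risk function of $M$ is $R_M(\theta):=\int_U w(\theta,u)\,\mathrm{Tr}\,\rho(\theta)M(du)$. $\mathcal{P}(\Theta)$ denotes the set of Borel probability measures on $\Theta$. *)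

theory Defs
  imports "HOL-Probability.Probability"
begin

class complex_vector = real_vector +
  fixes scaleC :: "complex \<Rightarrow> 'a \<Rightarrow> 'a" (infixr \<open>*\<^sub>C\<close> 75)
  assumes scaleC_add_right: "a *\<^sub>C (x + y) = a *\<^sub>C x + a *\<^sub>C y"
    and scaleC_add_left: "(a + b) *\<^sub>C x = a *\<^sub>C x + b *\<^sub>C x"
    and scaleC_scaleC: "a *\<^sub>C (b *\<^sub>C x) = (a * b) *\<^sub>C x"
    and scaleC_one: "1 *\<^sub>C x = x"
    and scaleR_scaleC: "scaleR r x = complex_of_real r *\<^sub>C x"

class complex_inner = complex_vector + real_normed_vector +
  fixes cinner :: "'a \<Rightarrow> 'a \<Rightarrow> complex"
  assumes cinner_commute: "cinner x y = cnj (cinner y x)"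
    and cinner_add_right: "cinner x (y + z) = cinner x y + cinner x z"
    and cinner_scaleC_right: "cinner x (r *\<^sub>C y) = r * cinner x y"
    and cinner_ge_zero: "0 \<le> Re (cinner x x)"
    and cinner_eq_zero_iff: "cinner x x = 0 \<longleftrightarrow> x = 0"
    and norm_eq_sqrt_cinner: "norm x = sqrt (Re (cinner x x))"

class chilbert_space = complex_inner + complete_space

definition bounded_clinear_op :: "('h::chilbert_space \<Rightarrow> 'h) \<Rightarrow> bool" where
  "bounded_clinear_op A \<longleftrightarrow>
     (\<forall>x y. A (x + y) = A x + A y) \<and> (\<forall>c x. A (c *\<^sub>C x) = c *\<^sub>C A x) \<and>
     (\<exists>K. \<forall>x. norm (A x) \<le> norm x * K)"

definition positive_op :: "('h::chilbert_space \<Rightarrow> 'h) \<Rightarrow> bool" where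
  "positive_op A \<longleftrightarrow> bounded_clinear_op A \<and>
     (\<forall>x. Im (cinner x (A x)) = 0 \<and> 0 \<le> Re (cinner x (A x)))"

definition op_le :: "('h::chilbert_space \<Rightarrow> 'h) \<Rightarrow> ('h \<Rightarrow> 'h) \<Rightarrow> bool" where
  "op_le A B \<longleftrightarrow> positive_op (\<lambda>z. B z - A z)"

text \<open>Nuclear representation \<open>A z = \<Sum>n \<langle>y n, z\<rangle> x n\<close> with \<open>\<Sum>n \<parallel>x n\<parallel> \<parallel>y n\<parallel> < \<infinity>\<close>.
  On a Hilbert space the operators admitting such a representation are exactly
  the trace-class operators, the trace is \<open>\<Sum>n \<langle>y n, x n\<rangle>\<close> and the trace norm is the
  infimum of \<open>\<Sum>n \<parallel>x n\<parallel> \<parallel>y n\<parallel>\<close> over all representations.\<close>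
definition nuclear_rep :: "('h::chilbert_space \<Rightarrow> 'h) \<Rightarrow> (nat \<Rightarrow> 'h) \<Rightarrow> (nat \<Rightarrow> 'h) \<Rightarrow> bool" where
  "nuclear_rep A x y \<longleftrightarrow> summable (\<lambda>n. norm (x n) * norm (y n)) \<and>
     (\<forall>z. (\<lambda>n. cinner (y n) z *\<^sub>C x n) sums A z)"

definition trace_class :: "('h::chilbert_space \<Rightarrow> 'h) \<Rightarrow> bool" where
  "trace_class A \<longleftrightarrow> bounded_clinear_op A \<and> (\<exists>x y. nuclear_rep A x y)"

definition trace :: "('h::chilbert_space \<Rightarrow> 'h) \<Rightarrow> complex" where
  "trace A = (let (x, y) = (SOME p. nuclear_rep A (fst p) (snd p)) in (\<Sum>n. cinner (y n) (x n)))"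

definition trace_norm :: "('h::chilbert_space \<Rightarrow> 'h) \<Rightarrow> real" where
  "trace_norm A = Inf {(\<Sum>n. norm (x n) * norm (y n)) | x y. nuclear_rep A x y}"

definition Kdelta :: "'a::metric_space set \<Rightarrow> real \<Rightarrow> ('a \<times> 'a) set" where
  "Kdelta K \<delta> = {(\<theta>, \<eta>). \<theta> \<in> K \<and> \<eta> \<in> K \<and> dist \<theta> \<eta> < \<delta>}"

text \<open>\<open>\<omega>_T(K_\<delta>)\<close>, with \<open>inf \<emptyset> = +\<infinity>\<close> (extended reals).\<close>
definition omega :: "('a::metric_space \<Rightarrow> 'h::chilbert_space \<Rightarrow> 'h) \<Rightarrow> 'a set \<Rightarrow> real \<Rightarrow> ereal" where
  "omega T K \<delta> = Inf (ereal ` {trace_norm X | X. trace_class X \<and>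
      (\<forall>(\<theta>, \<eta>) \<in> Kdelta K \<delta>. op_le (\<lambda>z. - X z) (\<lambda>z. T \<theta> z - T \<eta> z) \<and>
                              op_le (\<lambda>z. T \<theta> z - T \<eta> z) X)})"

definition regular :: "'a::metric_space set \<Rightarrow> ('a \<Rightarrow> 'h::chilbert_space \<Rightarrow> 'h) \<Rightarrow> bool" where
  "regular \<Theta> T \<longleftrightarrow> (\<forall>K. compact K \<and> K \<subseteq> \<Theta> \<longrightarrow> ((\<lambda>\<delta>. omega T K \<delta>) \<longlongrightarrow> 0) (at_right 0))"

definition quantum_model :: "'a::metric_space set \<Rightarrow> ('a \<Rightarrow> 'h::chilbert_space \<Rightarrow> 'h) \<Rightarrow> bool" where
  "quantum_model \<Theta> \<rho> \<longleftrightarrow>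
     (\<forall>\<theta>\<in>\<Theta>. positive_op (\<rho> \<theta>) \<and> trace_class (\<rho> \<theta>) \<and> trace (\<rho> \<theta>) = 1) \<and>
     inj_on \<rho> \<Theta> \<and> regular \<Theta> \<rho>"

abbreviation borel_sets_on :: "'b::topological_space set \<Rightarrow> 'b set set" where
  "borel_sets_on U \<equiv> sets (restrict_space borel U)"

definition is_povm :: "'b::metric_space set \<Rightarrow> ('b set \<Rightarrow> 'h::chilbert_space \<Rightarrow> 'h) \<Rightarrow> bool" where
  "is_povm U M \<longleftrightarrow>
     (\<forall>B \<in> borel_sets_on U. positive_op (M B)) \<and>
     (\<forall>Bs::nat \<Rightarrow> 'b set. range Bs \<subseteq> borel_sets_on U \<and> disjoint_family Bs \<longrightarrow>
        (\<forall>x y. (\<lambda>j. cinner x (M (Bs j) y)) sums cinner x (M (\<Union>j. Bs j) y))) \<and>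
     M U = id"

definition Povm :: "'b::metric_space set \<Rightarrow> ('b set \<Rightarrow> 'h::chilbert_space \<Rightarrow> 'h) set" where
  "Povm U = {M. is_povm U M}"

definition povm_measure :: "'b::metric_space set \<Rightarrow> ('h::chilbert_space \<Rightarrow> 'h) \<Rightarrow> ('b set \<Rightarrow> 'h \<Rightarrow> 'h) \<Rightarrow> 'b measure" where
  "povm_measure U T M = measure_of U (borel_sets_on U) (\<lambda>A. ennreal (Re (trace (T \<circ> M A))))"

definition risk :: "'b::metric_space set \<Rightarrow> ('a \<Rightarrow> 'h::chilbert_space \<Rightarrow> 'h) \<Rightarrow> ('a \<times> 'b \<Rightarrow> real) \<Rightarrow>
    ('b set \<Rightarrow> 'h \<Rightarrow> 'h) \<Rightarrow> 'a \<Rightarrow> real" where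
  "risk U \<rho> w M \<theta> = (\<integral>u. w (\<theta>, u) \<partial>(povm_measure U (\<rho> \<theta>) M))"

definition prob_measures :: "'a::metric_space set \<Rightarrow> 'a measure set" where
  "prob_measures \<Theta> = {\<pi>. prob_space \<pi> \<and> sets \<pi> = borel_sets_on \<Theta>}"

end

theory Submission
  imports Defs
begin

text \<open>Regularity of the model makes the risk functions \<open>R\<^sub>M\<close> equicontinuous on \<open>\<Theta>\<close>, uniformly in the
  POVM \<open>M\<close>: if \<open>- X \<le> \<rho> \<theta> - \<rho> \<eta> \<le> X\<close>, the risks at \<open>\<theta>\<close> and \<open>\<eta>\<close> differ by at most
  \<open>sup\<^sub>u |w (\<theta>, u) - w (\<eta>, u)| + sup w \<cdot> Tr X\<close>. Hence, up to \<open>\<epsilon>\<close>, \<open>\<Theta>\<close> may be replaced by a finite net,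
  and since the POVMs form a convex set on which the risk is convex, separation in finite dimension
  gives a prior supported on the net.

  The trace is handled through compressions to finite-dimensional subspaces: these determine
  \<open>Tr (T M)\<close> in the limit, which shows that it is independent of the nuclear representation and, by
  Cholesky elimination, nonnegative for positive \<open>T\<close> and \<open>M\<close>.\<close>

section \<open>Minimax over finitely many points\<close>

text \<open>By \<open>max\<close>, \<open>S\<close> misses the open quadrant below
  \<open>(v, v)\<close>, so a hyperplane separates them. The quadrant is unbounded below, which
  forces a normal vector with nonnegative entries, and normalising it gives the weights
  \<open>t\<close> and \<open>1 - t\<close>.\<close>

lemma two_point_minimax:
  fixes S :: "(real \<times> real) set"
  assumes "convex S" and max: "\<And>x y. (x, y) \<in> S \<Longrightarrow> v \<le> x \<or> v \<le> y"
  shows "\<exists>t\<in>{0..1}. \<forall>(x, y)\<in>S. v \<le> t * x + (1 - t) * y"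
proof (cases "S = {}")
  case True
  then show ?thesis by (auto intro: bexI[of _ 0])
next
  case False
  let ?T = "{..<v} \<times> {..<v}"
  have "?T \<inter> S = {}"
    using max by force
  then have "\<exists>a b. a \<noteq> 0 \<and> (\<forall>z\<in>?T. inner a z \<le> b) \<and> (\<forall>z\<in>S. b \<le> inner a z)"
    by (intro separating_hyperplane_sets) (use assms(1) False in \<open>auto intro!: convex_Times\<close>)
  then obtain a b where ab: "a \<noteq> 0" "\<forall>z\<in>?T. inner a z \<le> b" "\<forall>z\<in>S. b \<le> inner a z"
    by blast
  obtain p q where a: "a = (p, q)" by fastforce
  have T: "p * x + q * y \<le> b" if "x < v" "y < v" for x y
    using bspec[OF ab(2), of "(x, y)"] that by (simp add: a)
  \<comment> \<open>If \<open>p\<close> were negative, adding \<open>d / p\<close> to the first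
    coordinate of \<open>(v - 1, v - 1)\<close> would stay in the quadrant and yet raise the
    functional by \<open>d\<close>, which exceeds the gap to \<open>b\<close>; likewise for
    \<open>q\<close>.\<close>
  define d where "d = \<bar>b - (p + q) * (v - 1)\<bar> + 1"
  have d: "0 < d" "b < (p + q) * (v - 1) + d"
    by (simp_all add: d_def)
  have "0 \<le> p"
  proof (rule ccontr)
    assume p: "\<not> 0 \<le> p"
    then have "p * (v - 1 + d / p) + q * (v - 1) \<le> b"
      using d by (intro T) (auto simp: divide_pos_neg intro: order.strict_trans[of _ 0])
    with p d show False
      by (simp add: distrib_left distrib_right)
  qed
  have "0 \<le> q"
  proof (rule ccontr)
    assume q: "\<not> 0 \<le> q"
    then have "p * (v - 1) + q * (v - 1 + d / q) \<le> b"
      using d by (intro T) (auto simp: divide_pos_neg intro: order.strict_trans[of _ 0])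
    with q d show False
      by (simp add: distrib_left distrib_right)
  qed
  have pq: "0 < p + q"
    using \<open>0 \<le> p\<close> \<open>0 \<le> q\<close> ab(1) by (auto simp: a zero_prod_def)
  \<comment> \<open>The corner \<open>(v, v)\<close> is not in the open quadrant and is approached
    along the diagonal.\<close>
  have vb: "(p + q) * v \<le> b"
  proof (rule field_le_epsilon)
    fix e :: real assume "0 < e"
    then have "v - e / (p + q) < v"
      using pq by simp
    from T[OF this this] have "(p + q) * (v - e / (p + q)) \<le> b"
      by (simp only: distrib_right)
    then show "(p + q) * v \<le> b + e"
      using pq by (simp add: right_diff_distrib)
  qed
  have "v \<le> p / (p + q) * x + (1 - p / (p + q)) * y" if "(x, y) \<in> S" for x y
  proof -
    have "1 - p / (p + q) = q / (p + q)"
      using pq by (simp add: field_simps)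
    then have "p / (p + q) * x + (1 - p / (p + q)) * y = (p * x + q * y) / (p + q)"
      by (simp add: add_divide_distrib)
    moreover have "v * (p + q) \<le> p * x + q * y"
      using vb bspec[OF ab(3) that] by (simp add: a mult.commute)
    ultimately show ?thesis
      using pq by (simp add: pos_le_divide_eq)
  qed
  then show ?thesis
    using pq \<open>0 \<le> p\<close> \<open>0 \<le> q\<close> by (intro bexI[of _ "p / (p + q)"]) auto
qed

text \<open>Kneser's induction: the functions below \<open>v\<close> at the new point \<open>a\<close> again form a convex family,
  and the weights found for them reduce the claim to the two affine functionals \<open>f \<mapsto> f a\<close> and
  \<open>f \<mapsto> \<Sum>i\<in>G. p i * f i\<close>.\<close>
lemma finite_minimax:
  fixes F :: "'i set" and \<Phi> :: "('i \<Rightarrow> real) set"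
  assumes "finite F" "F \<noteq> {}"
    and convex: "\<And>f g t. f \<in> \<Phi> \<Longrightarrow> g \<in> \<Phi> \<Longrightarrow> 0 \<le> t \<Longrightarrow> t \<le> 1 \<Longrightarrow> (\<lambda>i. t * f i + (1 - t) * g i) \<in> \<Phi>"
    and max: "\<And>f. f \<in> \<Phi> \<Longrightarrow> \<exists>i\<in>F. v \<le> f i"
  shows "\<exists>p. (\<forall>i\<in>F. 0 \<le> p i) \<and> sum p F = 1 \<and> (\<forall>f\<in>\<Phi>. v \<le> (\<Sum>i\<in>F. p i * f i))"
  using assms
proof (induction F arbitrary: \<Phi> rule: finite_ne_induct)
  case (singleton i)
  then show ?case by (intro exI[of _ "\<lambda>_. 1"]) auto
next
  case (insert a G)
  let ?\<Psi> = "{f \<in> \<Phi>. f a < v}"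
  have "\<exists>p. (\<forall>i\<in>G. 0 \<le> p i) \<and> sum p G = 1 \<and> (\<forall>f\<in>?\<Psi>. v \<le> (\<Sum>i\<in>G. p i * f i))"
  proof (rule insert.IH)
    fix f g t assume fg: "f \<in> ?\<Psi>" "g \<in> ?\<Psi>" and t: "0 \<le> t" "t \<le> (1::real)"
    have "t * f a + (1 - t) * g a < v"
      using fg t by (intro convex_bound_lt) auto
    then show "(\<lambda>i. t * f i + (1 - t) * g i) \<in> ?\<Psi>"
      using insert.prems(1) fg t by auto
  next
    fix f assume "f \<in> ?\<Psi>"
    then show "\<exists>i\<in>G. v \<le> f i"
      using insert.prems(2)[of f] by auto
  qed
  then obtain p where p: "\<And>i. i \<in> G \<Longrightarrow> 0 \<le> p i" "sum p G = 1"
      "\<And>f. f \<in> \<Phi> \<Longrightarrow> f a < v \<Longrightarrow> v \<le> (\<Sum>i\<in>G. p i * f i)"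
    by auto
  let ?h = "\<lambda>f. (f a, \<Sum>i\<in>G. p i * f i)"
  have "convex (?h ` \<Phi>)"
  proof (rule convexI, clarify)
    fix f g and s t :: real assume fg: "f \<in> \<Phi>" "g \<in> \<Phi>" and st: "0 \<le> s" "0 \<le> t" "s + t = 1"
    have t: "t = 1 - s" using st by simp
    let ?k = "\<lambda>i. s * f i + (1 - s) * g i"
    have "?k \<in> \<Phi>"
      using insert.prems(1)[OF fg, of s] st by simp
    moreover have "s *\<^sub>R ?h f + t *\<^sub>R ?h g = ?h ?k"
      by (simp add: t sum_distrib_left algebra_simps flip: sum.distrib sum_subtractf)
    ultimately show "s *\<^sub>R ?h f + t *\<^sub>R ?h g \<in> ?h ` \<Phi>"
      by (intro rev_image_eqI)
  qed
  \<comment> \<open>Every image point has a coordinate at least \<open>v\<close>: either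
    \<open>v \<le> f a\<close>, or \<open>f \<in> ?\<Psi>\<close> and \<open>p(3)\<close> bounds the
    weighted sum.\<close>
  then obtain t where t: "0 \<le> t" "t \<le> 1"
      "\<And>f. f \<in> \<Phi> \<Longrightarrow> v \<le> t * f a + (1 - t) * (\<Sum>i\<in>G. p i * f i)"
    using two_point_minimax[of "?h ` \<Phi>" v] p(3) by fastforce
  define q where "q i = (if i = a then t else (1 - t) * p i)" for i
  have qG: "(\<Sum>i\<in>G. q i * f i) = (1 - t) * (\<Sum>i\<in>G. p i * f i)" for f :: "'i \<Rightarrow> real"
    unfolding sum_distrib_left using insert.hyps by (intro sum.cong) (auto simp: q_def)
  have "sum q (insert a G) = 1"
    using qG[of "\<lambda>_. 1"] insert.hyps p(2) by (simp add: q_def)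
  moreover have "v \<le> (\<Sum>i\<in>insert a G. q i * f i)" if "f \<in> \<Phi>" for f
    using t(3)[OF that] qG[of f] insert.hyps by (simp add: q_def)
  moreover have "0 \<le> q i" if "i \<in> insert a G" for i
    using that t p(1) by (auto simp: q_def)
  ultimately show ?case by blast
qed

section \<open>Measures\<close>

text \<open>Domination on sets passes to integrals by the usual induction over measurable functions;
  values in \<open>ennreal\<close> keep every step free of integrability conditions.\<close>

lemma nn_integral_le_combination:
  assumes sets: "sets N1 = sets N" "sets N2 = sets N"
    and le: "\<And>A. A \<in> sets N \<Longrightarrow> emeasure N A \<le> a * emeasure N1 A + b * emeasure N2 A"
    and f: "f \<in> borel_measurable N"
  shows "(\<integral>\<^sup>+ x. f x \<partial>N) \<le> a * (\<integral>\<^sup>+ x. f x \<partial>N1) + b * (\<integral>\<^sup>+ x. f x \<partial>N2)"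
proof -
  have M1: "f \<in> borel_measurable N1" and M2: "f \<in> borel_measurable N2"
    if "f \<in> borel_measurable N" for f :: "_ \<Rightarrow> ennreal"
    using that measurable_cong_sets[OF sets(1) refl] measurable_cong_sets[OF sets(2) refl] by auto
  note sp = sets_eq_imp_space_eq[OF sets(1)] sets_eq_imp_space_eq[OF sets(2)]
  from f show ?thesis
  proof (induction f rule: borel_measurable_induct)
    case (cong f g)
    moreover have "integral\<^sup>N N f = integral\<^sup>N N g" "integral\<^sup>N N1 f = integral\<^sup>N N1 g"
      "integral\<^sup>N N2 f = integral\<^sup>N N2 g"
      using cong(3) sp by (auto intro!: nn_integral_cong)
    ultimately show ?case by simp
  next
    case (set A)
    then show ?case using le sets by simp
  next
    case (mult u c)
    have "integral\<^sup>N N (\<lambda>x. c * u x) = c * integral\<^sup>N N u"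
      using mult by (intro nn_integral_cmult)
    also have "\<dots> \<le> c * (a * integral\<^sup>N N1 u + b * integral\<^sup>N N2 u)"
      using mult by (intro mult_left_mono) auto
    also have "\<dots> = a * (c * integral\<^sup>N N1 u) + b * (c * integral\<^sup>N N2 u)"
      by (simp add: algebra_simps)
    finally show ?case
      using mult by (simp add: nn_integral_cmult M1 M2)
  next
    case (add u v)
    have "integral\<^sup>N N (\<lambda>x. v x + u x) = integral\<^sup>N N v + integral\<^sup>N N u"
      using add by (intro nn_integral_add)
    also have "\<dots> \<le> (a * integral\<^sup>N N1 v + b * integral\<^sup>N N2 v) + (a * integral\<^sup>N N1 u + b * integral\<^sup>N N2 u)"
      using add by (intro add_mono) auto
    also have "\<dots> = a * (integral\<^sup>N N1 v + integral\<^sup>N N1 u) + b * (integral\<^sup>N N2 v + integral\<^sup>N N2 u)"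
      by (simp add: algebra_simps)
    finally show ?case
      using add by (simp add: nn_integral_add M1 M2)
  next
    case (seq U)
    have mono: "integral\<^sup>N M (U i) \<le> integral\<^sup>N M (SUP i. U i)" for i and M :: "'a measure"
      by (intro nn_integral_mono) (auto intro: SUP_upper simp: image_comp)
    have "integral\<^sup>N N (SUP i. U i) = (SUP i. integral\<^sup>N N (U i))"
      using nn_integral_monotone_convergence_SUP[OF seq(3) seq(1)]
      by (simp add: Sup_fun_def image_comp)
    also have "\<dots> \<le> a * integral\<^sup>N N1 (SUP i. U i) + b * integral\<^sup>N N2 (SUP i. U i)"
      by (intro SUP_least order_trans[OF seq.IH] add_mono mult_left_mono mono) auto
    finally show ?case .
  qed
qed

text \<open>On a finite measure a bounded nonnegative measurable function is integrable, so its
  integral agrees with the extended one and the previous inequality carries over.\<close>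

lemma integral_le_combination:
  fixes f :: "'a \<Rightarrow> real"
  assumes sets: "sets N1 = sets N" "sets N2 = sets N"
    and fin: "finite_measure N" "finite_measure N1" "finite_measure N2"
    and ab: "0 \<le> a" "0 \<le> b"
    and le: "\<And>A. A \<in> sets N \<Longrightarrow> measure N A \<le> a * measure N1 A + b * measure N2 A"
    and f: "f \<in> borel_measurable N" and f0: "\<And>x. x \<in> space N \<Longrightarrow> 0 \<le> f x"
    and fC: "\<And>x. x \<in> space N \<Longrightarrow> f x \<le> C"
  shows "(\<integral>x. f x \<partial>N) \<le> a * (\<integral>x. f x \<partial>N1) + b * (\<integral>x. f x \<partial>N2)"
proof -
  note sp = sets_eq_imp_space_eq[OF sets(1)] sets_eq_imp_space_eq[OF sets(2)]
  have eq: "(\<integral>\<^sup>+ x. ennreal (f x) \<partial>M) = ennreal (\<integral>x. f x \<partial>M)" "0 \<le> (\<integral>x. f x \<partial>M)"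
    if "sets M = sets N" "finite_measure M" for M
  proof -
    interpret M: finite_measure M by fact
    have "f \<in> borel_measurable M"
      using f measurable_cong_sets[OF that(1) refl] by blast
    moreover have "space M = space N"
      using that sets_eq_imp_space_eq by blast
    ultimately have "integrable M f"
      using f0 fC by (intro M.integrable_const_bound[of _ C]) auto
    then show "(\<integral>\<^sup>+ x. ennreal (f x) \<partial>M) = ennreal (\<integral>x. f x \<partial>M)"
      using f0 \<open>space M = space N\<close> by (intro nn_integral_eq_integral) auto
    show "0 \<le> (\<integral>x. f x \<partial>M)"
      using f0 \<open>space M = space N\<close> by (intro integral_nonneg_AE) auto
  qed
  have "emeasure N A \<le> ennreal a * emeasure N1 A + ennreal b * emeasure N2 A" if "A \<in> sets N" for A
    using le[OF that] ab fin
    by (simp add: finite_measure.emeasure_eq_measure flip: ennreal_mult ennreal_plus)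
  then have "(\<integral>\<^sup>+ x. ennreal (f x) \<partial>N) \<le>
      ennreal a * (\<integral>\<^sup>+ x. ennreal (f x) \<partial>N1) + ennreal b * (\<integral>\<^sup>+ x. ennreal (f x) \<partial>N2)"
    using f sets by (intro nn_integral_le_combination) auto
  then show ?thesis
    using ab eq(2)[OF sets(1) fin(2)] eq(2)[OF sets(2) fin(3)]
    by (simp add: eq sets fin flip: ennreal_mult ennreal_plus)
qed

text \<open>A point measure on \<open>F\<close> has all subsets of \<open>F\<close> as its
  measurable sets. Pushing it forward along the identity installs the \<sigma>-algebra that
  \<open>prob_measures\<close> requires.\<close>

lemma finite_prob_measure:
  fixes \<Theta> :: "'a::metric_space set"
  assumes "finite F" "F \<subseteq> \<Theta>" "\<And>i. i \<in> F \<Longrightarrow> 0 \<le> p i" "sum p F = 1"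
  obtains \<pi> where "\<pi> \<in> prob_measures \<Theta>"
    and "\<And>f::'a \<Rightarrow> real. f \<in> borel_measurable (restrict_space borel \<Theta>) \<Longrightarrow>
      (\<integral>\<theta>. f \<theta> \<partial>\<pi>) = (\<Sum>i\<in>F. p i * f i)"
proof -
  let ?P = "point_measure F (\<lambda>i. ennreal (p i))" and ?R = "restrict_space borel \<Theta> :: 'a measure"
  have id: "(\<lambda>x. x) \<in> measurable ?P ?R"
    using assms(2) by (auto simp: measurable_def space_point_measure sets_point_measure space_restrict_space)
  have "prob_space ?P"
    by (rule prob_spaceI)
      (use assms in \<open>simp add: space_point_measure emeasure_point_measure_finite sum_ennreal\<close>)
  then have "distr ?P ?R (\<lambda>x. x) \<in> prob_measures \<Theta>"
    using prob_space.prob_space_distr[OF _ id] by (simp add: prob_measures_def)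
  moreover have "(\<integral>\<theta>. f \<theta> \<partial>distr ?P ?R (\<lambda>x. x)) = (\<Sum>i\<in>F. p i * f i)"
    if "f \<in> borel_measurable ?R" for f :: "'a \<Rightarrow> real"
    using integral_distr[OF id that] lebesgue_integral_point_measure_finite[of F p f] assms by simp
  ultimately show ?thesis
    by (rule that)
qed

section \<open>Operators on a Hilbert space\<close>

lemma cinner_add_left: "cinner (x + y) z = cinner x z + cinner y (z::'h::chilbert_space)"
  by (metis cinner_commute cinner_add_right complex_cnj_add)

lemma cinner_scaleC_left: "cinner (c *\<^sub>C x) (y::'h::chilbert_space) = cnj c * cinner x y"
  by (metis cinner_commute cinner_scaleC_right complex_cnj_mult)

lemma scaleC_zero_left: "0 *\<^sub>C x = (0::'h::chilbert_space)"
  using scaleR_scaleC[of 0 x] by simp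

lemma cinner_zero_right: "cinner x (0::'h::chilbert_space) = 0"
  using cinner_add_right[of x 0 0] by simp

lemma cinner_zero_left: "cinner 0 (x::'h::chilbert_space) = 0"
  using cinner_add_left[of 0 0 x] by simp

lemma cinner_diff_right: "cinner x (y - z) = cinner x y - cinner x (z::'h::chilbert_space)"
  using cinner_add_right[of x "y - z" z] by simp

lemma cinner_diff_left: "cinner (x - y) z = cinner x z - cinner y (z::'h::chilbert_space)"
  using cinner_add_left[of "x - y" y z] by simp

lemma cinner_scaleR_right: "cinner x (r *\<^sub>R y) = r * cinner x (y::'h::chilbert_space)"
  by (simp add: scaleR_scaleC cinner_scaleC_right)

lemma cinner_scaleR_left: "cinner (r *\<^sub>R x) y = r * cinner x (y::'h::chilbert_space)"
  by (simp add: scaleR_scaleC cinner_scaleC_left)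

lemma cinner_sum_right: "cinner x (\<Sum>i\<in>I. f i) = (\<Sum>i\<in>I. cinner x (f i::'h::chilbert_space))"
  by (induction I rule: infinite_finite_induct) (auto simp: cinner_add_right cinner_zero_right)

lemma cinner_sum_left: "cinner (\<Sum>i\<in>I. f i) x = (\<Sum>i\<in>I. cinner (f i::'h::chilbert_space) x)"
  by (induction I rule: infinite_finite_induct) (auto simp: cinner_add_left cinner_zero_left)

lemmas cinner_simps = cinner_add_left cinner_add_right cinner_diff_left cinner_diff_right
  cinner_scaleC_left cinner_scaleC_right cinner_scaleR_left cinner_scaleR_right
  cinner_zero_left cinner_zero_right

lemma cinner_self: "cinner x x = complex_of_real ((norm (x::'h::chilbert_space))\<^sup>2)"
proof -
  have "Im (cinner x x) = 0"
    using cinner_commute[of x x] by (metis Reals_cnj_iff complex_is_Real_iff)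
  then show ?thesis
    using norm_eq_sqrt_cinner[of x] cinner_ge_zero[of x] by (simp add: complex_eq_iff)
qed

section \<open>Positive operators and the Cauchy-Schwarz inequality\<close>

lemma positive_opD:
  assumes "positive_op A"
  shows positive_op_bounded: "bounded_clinear_op A"
    and positive_op_Im: "Im (cinner x (A x)) = 0"
    and positive_op_Re: "0 \<le> Re (cinner x (A x))"
    and positive_op_add: "A (x + y) = A x + A y"
    and positive_op_scaleC: "A (c *\<^sub>C x) = c *\<^sub>C A x"
  using assms unfolding positive_op_def bounded_clinear_op_def by auto

text \<open>Polarization: the quadratic form is real at \<open>x + y\<close> and at
  \<open>x + \<i> *\<^sub>C y\<close>, which settles the imaginary and the real part in
  turn.\<close>

lemma positive_op_selfadjoint:
  fixes A :: "'h::chilbert_space \<Rightarrow> 'h"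
  assumes "positive_op A"
  shows "cinner (A x) y = cinner x (A y)"
proof -
  note lin = positive_op_add[OF assms] positive_op_scaleC[OF assms]
  have 1: "Im (cinner x (A y)) + Im (cinner y (A x)) = 0"
    using positive_op_Im[OF assms, of "x + y"] positive_op_Im[OF assms, of x]
      positive_op_Im[OF assms, of y]
    by (simp add: lin cinner_simps)
  have 2: "Re (cinner x (A y)) - Re (cinner y (A x)) = 0"
    using positive_op_Im[OF assms, of "x + \<i> *\<^sub>C y"] positive_op_Im[OF assms, of x]
      positive_op_Im[OF assms, of y]
    by (simp add: lin cinner_simps)
  have "cinner x (A y) = cnj (cinner y (A x))"
    using 1 2 by (simp add: complex_eq_iff)
  then show ?thesis
    using cinner_commute[of "A x" y] by simp
qed

lemma positive_op_Cauchy_Schwarz: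
  fixes A :: "'h::chilbert_space \<Rightarrow> 'h"
  assumes "positive_op A"
  shows "(cmod (cinner x (A y)))\<^sup>2 \<le> Re (cinner x (A x)) * Re (cinner y (A y))"
proof -
  note lin = positive_op_add[OF assms] positive_op_scaleC[OF assms]
  define a where "a = Re (cinner x (A x))"
  define b where "b = Re (cinner y (A y))"
  define c where "c = cinner x (A y)"
  have cc: "cinner y (A x) = cnj c"
    using positive_op_selfadjoint[OF assms] cinner_commute unfolding c_def by metis
  have aa: "cinner x (A x) = complex_of_real a" and bb: "cinner y (A y) = complex_of_real b"
    using positive_op_Im[OF assms] unfolding a_def b_def by (simp_all add: complex_eq_iff)
  \<comment> \<open>The factor \<open>cnj c\<close> in the multiple of \<open>y\<close> makes the
    cross terms real, leaving a real quadratic in \<open>t\<close>.\<close>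
  have key: "0 \<le> a - 2 * t * (cmod c)\<^sup>2 + t\<^sup>2 * (cmod c)\<^sup>2 * b" for t :: real
  proof -
    define s where "s = - complex_of_real t * cnj c"
    have "cinner (x + s *\<^sub>C y) (A (x + s *\<^sub>C y)) =
        complex_of_real a + s * c + cnj s * cnj c + cnj s * s * complex_of_real b"
      by (simp add: lin cinner_simps aa bb cc c_def[symmetric] algebra_simps)
    also have "\<dots> = complex_of_real (a - 2 * t * (cmod c)\<^sup>2 + t\<^sup>2 * (cmod c)\<^sup>2 * b)"
      unfolding s_def using complex_norm_square[of c]
      by (simp add: algebra_simps power2_eq_square)
    finally show ?thesis
      using positive_op_Re[OF assms, of "x + s *\<^sub>C y"] by (metis Re_complex_of_real)
  qed
  have "0 \<le> b"
    unfolding b_def by (rule positive_op_Re[OF assms])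
  show ?thesis
  proof (cases "b = 0")
    case True
    \<comment> \<open>The form may be degenerate. Then the quadratic is affine in \<open>t\<close>,
      and the value of \<open>t\<close> inserted below would turn it into
      \<open>a - (a + 1) = -1\<close>.\<close>
    have "c = 0"
    proof (rule ccontr)
      assume "c \<noteq> 0"
      then show False
        using key[of "(a + 1) / (2 * (cmod c)\<^sup>2)"] True by (simp add: field_simps)
    qed
    then show ?thesis
      using True unfolding a_def b_def c_def by simp
  next
    case False
    with \<open>0 \<le> b\<close> have "0 < b" by simp
    \<comment> \<open>At \<open>1 / b\<close> the quadratic is smallest.\<close>
    then show ?thesis
      using key[of "1 / b"] unfolding a_def b_def c_def
      by (simp add: field_simps power2_eq_square)
  qed
qed

text \<open>Specialises facts on positive operators to the inner product itself, and lets the plain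
  trace be treated as the trace of a product with \<open>id\<close>.\<close>

lemma positive_op_id: "positive_op (id :: 'h::chilbert_space \<Rightarrow> 'h)"
  unfolding positive_op_def bounded_clinear_op_def
  by (auto simp: cinner_self intro!: exI[of _ 1])

lemma norm_cinner_le: "cmod (cinner x y) \<le> norm x * norm (y::'h::chilbert_space)"
proof -
  have "(cmod (cinner x y))\<^sup>2 \<le> (norm x * norm y)\<^sup>2"
    using positive_op_Cauchy_Schwarz[OF positive_op_id, of x y]
    by (simp add: cinner_self power_mult_distrib)
  then show ?thesis
    by (rule power2_le_imp_le) simp
qed

lemma bounded_linear_cinner_right: "bounded_linear (cinner (x::'h::chilbert_space))"
  by (rule bounded_linear_intro[where K = "norm x"])
    (auto simp: cinner_simps scaleR_conv_of_real mult.commute[of _ "norm x"] norm_cinner_le)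

lemma bounded_clinear_op_bound:
  assumes "bounded_clinear_op A"
  obtains K where "0 \<le> K" "\<And>x. norm (A x) \<le> K * norm x"
proof -
  obtain K where K: "\<And>x. norm (A x) \<le> norm x * K"
    using assms unfolding bounded_clinear_op_def by blast
  have "norm (A x) \<le> \<bar>K\<bar> * norm x" for x
    using K[of x] mult_left_mono[OF abs_ge_self[of K] norm_ge_zero[of x]]
    by (simp add: mult.commute)
  then show ?thesis
    using that[of "\<bar>K\<bar>"] by simp
qed

lemma bounded_clinear_op_zero: "bounded_clinear_op A \<Longrightarrow> A 0 = 0"
  unfolding bounded_clinear_op_def by (metis add_cancel_right_right)

lemma bounded_clinear_op_sum:
  assumes "bounded_clinear_op A"
  shows "A (\<Sum>i\<in>I. f i) = (\<Sum>i\<in>I. A (f i))"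
  using assms bounded_clinear_op_zero[OF assms]
  by (induction I rule: infinite_finite_induct) (auto simp: bounded_clinear_op_def)

section \<open>The trace\<close>

definition orthonormal :: "'h::chilbert_space set \<Rightarrow> bool" where
  "orthonormal E \<longleftrightarrow> finite E \<and> (\<forall>e\<in>E. \<forall>f\<in>E. cinner e f = (if e = f then 1 else 0))"

definition proj :: "'h::chilbert_space set \<Rightarrow> 'h \<Rightarrow> 'h" where
  "proj E z = (\<Sum>e\<in>E. cinner e z *\<^sub>C e)"

lemma cinner_proj:
  assumes "orthonormal E" "e \<in> E"
  shows "cinner e (proj E z) = cinner e z"
proof -
  have "cinner e (proj E z) = (\<Sum>f\<in>E. if f = e then cinner e z else 0)"
    unfolding proj_def cinner_sum_right cinner_scaleC_right
    using assms by (intro sum.cong) (auto simp: orthonormal_def)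
  then show ?thesis
    using assms by (simp add: orthonormal_def)
qed

text \<open>The squared norm of \<open>proj E z\<close> equals its inner product with
  \<open>z\<close>, so Cauchy-Schwarz leaves one factor to cancel.\<close>

lemma norm_proj_le:
  assumes "orthonormal E"
  shows "norm (proj E z) \<le> norm z"
proof -
  have "cinner (proj E z) (proj E z) = cinner (proj E z) z"
    unfolding proj_def[of E z] cinner_sum_left cinner_scaleC_left
    unfolding proj_def[symmetric] using cinner_proj[OF assms] by simp
  then have "(norm (proj E z))\<^sup>2 = cmod (cinner (proj E z) z)"
    by (metis cinner_self norm_of_real abs_of_nonneg zero_le_power2)
  also have "\<dots> \<le> norm (proj E z) * norm z"
    by (rule norm_cinner_le)
  finally show ?thesis
    by (cases "proj E z = 0") (simp_all add: power2_eq_square)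
qed

text \<open>Gram-Schmidt: the residual of a new vector either vanishes or is normalised and added to
  \<open>E\<close>.\<close>

lemma orthonormal_span_finite:
  fixes X :: "'h::chilbert_space set"
  assumes "finite X"
  shows "\<exists>E. orthonormal E \<and> (\<forall>x\<in>X. proj E x = x)"
  using assms
proof (induction X)
  case empty
  show ?case
    by (rule exI[of _ "{}"]) (simp add: orthonormal_def)
next
  case (insert x X)
  then obtain E where E: "orthonormal E" "\<And>y. y \<in> X \<Longrightarrow> proj E y = y"
    by auto
  have fin: "finite E"
    using E by (simp add: orthonormal_def)
  define r where "r = x - proj E x"
  show ?case
  proof (cases "r = 0")
    case True
    then show ?thesis
      using E by (intro exI[of _ E]) (auto simp: r_def)
  next
    case False
    define u where "u = (1 / norm r) *\<^sub>R r"
    have er: "cinner e r = 0" if "e \<in> E" for e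
      using cinner_proj[OF E(1) that] by (simp add: r_def cinner_simps)
    have eu: "cinner e u = 0" if "e \<in> E" for e
      using er[OF that] by (simp add: u_def cinner_simps)
    have ue: "cinner u e = 0" if "e \<in> E" for e
      using eu[OF that] cinner_commute[of u e] by simp
    have uu: "cinner u u = 1"
      using False by (simp add: u_def cinner_simps cinner_self power2_eq_square)
    have "u \<notin> E"
      using eu uu by auto
    have on: "orthonormal (insert u E)"
      using E(1) eu ue uu by (auto simp: orthonormal_def)
    have pr: "proj (insert u E) z = cinner u z *\<^sub>C u + proj E z" for z
      using \<open>u \<notin> E\<close> fin by (simp add: proj_def)
    \<comment> \<open>Hence vectors already fixed by \<open>proj E\<close> have no component along
      \<open>u\<close> and stay fixed.\<close>
    have uP: "cinner u (proj E z) = 0" for z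
      using ue by (simp add: proj_def cinner_sum_right cinner_scaleC_right)
    have "proj (insert u E) y = y" if "y \<in> X" for y
      using pr[of y] uP[of y] E(2)[OF that] by (simp add: scaleC_zero_left)
    moreover have "proj (insert u E) x = x"
    proof -
      have "cinner u x = cinner u r"
        using uP[of x] by (simp add: r_def cinner_simps)
      also have "\<dots> = complex_of_real (norm r)"
        using False by (simp add: u_def cinner_simps cinner_self power2_eq_square)
      finally have "cinner u x *\<^sub>C u = r"
        using False by (simp add: scaleR_scaleC[symmetric] u_def)
      then show ?thesis
        using pr[of x] by (simp add: r_def)
    qed
    ultimately show ?thesis
      using on by (intro exI[of _ "insert u E"]) auto
  qed
qed

text \<open>These subspaces, adapted to finitely many sequences at once, replace an orthonormal
  basis of the possibly nonseparable space and allow several nuclear representations to be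
  compared.\<close>

lemma orthonormal_exhaustion:
  fixes Z :: "(nat \<Rightarrow> 'h::chilbert_space) set"
  assumes "finite Z"
  obtains E where "\<And>N. orthonormal (E N)"
    and "\<And>N n z. z \<in> Z \<Longrightarrow> n < N \<Longrightarrow> proj (E N) (z n) = z n"
proof -
  have "\<exists>E. orthonormal E \<and> (\<forall>x\<in>(\<Union>z\<in>Z. z ` {..<N}). proj E x = x)" for N
    by (rule orthonormal_span_finite) (use assms in auto)
  then obtain E where "\<And>N. orthonormal (E N) \<and> (\<forall>x\<in>(\<Union>z\<in>Z. z ` {..<N}). proj (E N) x = x)"
    by metis
  then show ?thesis
    by (intro that[of E]) auto
qed

text \<open>The trace of the product of the compressions of \<open>A\<close> and \<open>B\<close> to the span of an orthonormal \<open>E\<close>.\<close>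
definition compr_trace :: "'h::chilbert_space set \<Rightarrow> ('h \<Rightarrow> 'h) \<Rightarrow> ('h \<Rightarrow> 'h) \<Rightarrow> complex" where
  "compr_trace E A B = (\<Sum>e\<in>E. \<Sum>f\<in>E. cinner e (B f) * cinner f (A e))"

text \<open>The right side is \<open>compr_trace\<close> with the rank-one operator
  \<open>z \<mapsto> cinner y z *\<^sub>C x\<close> in the place of \<open>A\<close>; the nuclear
  series and the elimination step below both use it in this role.\<close>

lemma cinner_proj_op_proj:
  assumes "bounded_clinear_op B"
  shows "cinner (proj E y) (B (proj E x)) =
    (\<Sum>e\<in>E. \<Sum>f\<in>E. cinner e (B f) * (cinner y e * cinner f x))"
proof -
  have "B (proj E x) = (\<Sum>f\<in>E. cinner f x *\<^sub>C B f)"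
    unfolding proj_def bounded_clinear_op_sum[OF assms]
    using assms by (simp add: bounded_clinear_op_def)
  moreover have "cnj (cinner e y) = cinner y e" for e
    using cinner_commute[of y e] by simp
  ultimately show ?thesis
    by (subst sum.swap) (simp add: proj_def cinner_sum_left cinner_sum_right cinner_simps
        sum_distrib_left algebra_simps)
qed

text \<open>Each \<open>cinner f (A e)\<close> expands into the nuclear series, which may be
  exchanged with the finite double sum over \<open>E\<close>.\<close>

lemma nuclear_rep_compr_trace_sums:
  assumes "nuclear_rep A x y" "bounded_clinear_op B"
  shows "(\<lambda>n. cinner (proj E (y n)) (B (proj E (x n)))) sums compr_trace E A B"
proof -
  have "(\<lambda>n. cinner (y n) e * cinner f (x n)) sums cinner f (A e)" for e f
    using bounded_linear.sums[OF bounded_linear_cinner_right[of f],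
        of "\<lambda>n. cinner (y n) e *\<^sub>C x n" "A e"] assms(1)
    by (simp add: nuclear_rep_def cinner_simps)
  then show ?thesis
    unfolding cinner_proj_op_proj[OF assms(2)] compr_trace_def by (intro sums_sum sums_mult)
qed

lemma nuclear_rep_summable:
  assumes "nuclear_rep A x y" "bounded_clinear_op B"
  shows "summable (\<lambda>n. cinner (y n) (B (x n)))"
proof -
  obtain K where K: "0 \<le> K" "\<And>x. norm (B x) \<le> K * norm x"
    using bounded_clinear_op_bound[OF assms(2)] by blast
  have "norm (cinner (y n) (B (x n))) \<le> K * (norm (x n) * norm (y n))" for n
    using norm_cinner_le[of "y n" "B (x n)"] mult_left_mono[OF K(2)[of "x n"] norm_ge_zero[of "y n"]]
    by (simp add: algebra_simps)
  moreover have "summable (\<lambda>n. K * (norm (x n) * norm (y n)))"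
    using assms(1) by (intro summable_mult) (simp add: nuclear_rep_def)
  ultimately show ?thesis
    by (rule summable_comparison_test'[rotated])
qed

text \<open>Dominated convergence for series: the term of index \<open>n\<close> is constant once
  \<open>N\<close> exceeds \<open>n\<close>, and projections do not increase norms. The left side
  mentions the representation only through the choice of \<open>E\<close>.\<close>

lemma compr_trace_tendsto:
  assumes rep: "nuclear_rep A x y" and B: "bounded_clinear_op B"
    and E: "\<And>N. orthonormal (E N)"
    and x: "\<And>N n. n < N \<Longrightarrow> proj (E N) (x n) = x n"
    and y: "\<And>N n. n < N \<Longrightarrow> proj (E N) (y n) = y n"
  shows "(\<lambda>N. compr_trace (E N) A B) \<longlonglongrightarrow> (\<Sum>n. cinner (y n) (B (x n)))"
proof -
  obtain K where K: "0 \<le> K" "\<And>x. norm (B x) \<le> K * norm x"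
    using bounded_clinear_op_bound[OF B] by blast
  let ?a = "\<lambda>n N. cinner (proj (E N) (y n)) (B (proj (E N) (x n)))"
  have bound: "norm (?a n N) \<le> K * (norm (x n) * norm (y n))" for n N
  proof -
    have "norm (?a n N) \<le> norm (proj (E N) (y n)) * norm (B (proj (E N) (x n)))"
      by (rule norm_cinner_le)
    also have "\<dots> \<le> norm (y n) * (K * norm (proj (E N) (x n)))"
      using K norm_proj_le[OF E] by (intro mult_mono) auto
    also have "\<dots> \<le> norm (y n) * (K * norm (x n))"
      using K norm_proj_le[OF E] by (intro mult_left_mono) auto
    finally show ?thesis
      by (simp add: algebra_simps)
  qed
  have "(\<lambda>N. \<Sum>n. ?a n N) \<longlonglongrightarrow> (\<Sum>n. cinner (y n) (B (x n)))"
  proof (rule tannerys_theorem[THEN conjunct2, THEN conjunct2])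
    show "(\<lambda>N. ?a n N) \<longlonglongrightarrow> cinner (y n) (B (x n))" for n
      by (rule tendsto_eventually)
        (use x y in \<open>auto intro!: eventually_sequentiallyI[of "Suc n"]\<close>)
    show "summable (\<lambda>n. K * (norm (x n) * norm (y n)))"
      using rep by (intro summable_mult) (simp add: nuclear_rep_def)
  qed (auto intro!: always_eventually bound)
  then show ?thesis
    using sums_unique[OF nuclear_rep_compr_trace_sums[OF rep B]] by simp
qed

text \<open>\<open>trace\<close> evaluates a representation picked by \<open>SOME\<close>. Along
  subspaces that exhaust both the picked and the given one, the two sums are limits of the same
  sequence of compressions.\<close>

lemma nuclear_rep_trace:
  assumes "nuclear_rep A x y"
  shows "trace A = (\<Sum>n. cinner (y n) (x n))"
proof -
  define p where "p = (SOME p. nuclear_rep A (fst p) (snd p))"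
  have p: "nuclear_rep A (fst p) (snd p)"
    unfolding p_def by (rule someI[of _ "(x, y)"]) (simp add: assms)
  obtain E where E: "\<And>N. orthonormal (E N)"
    "\<And>N n z. z \<in> {x, y, fst p, snd p} \<Longrightarrow> n < N \<Longrightarrow> proj (E N) (z n) = z n"
    using orthonormal_exhaustion[of "{x, y, fst p, snd p}"] by auto
  note bid = positive_op_bounded[OF positive_op_id]
  have "(\<lambda>N. compr_trace (E N) A id) \<longlonglongrightarrow> (\<Sum>n. cinner (y n) (id (x n)))"
    by (rule compr_trace_tendsto[OF assms bid E(1)]) (auto intro: E)
  moreover have "(\<lambda>N. compr_trace (E N) A id) \<longlonglongrightarrow> (\<Sum>n. cinner (snd p n) (id (fst p n)))"
    by (rule compr_trace_tendsto[OF p bid E(1)]) (auto intro: E)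
  ultimately have "(\<Sum>n. cinner (y n) (x n)) = (\<Sum>n. cinner (snd p n) (fst p n))"
    using LIMSEQ_unique by auto
  then show ?thesis
    unfolding trace_def p_def[symmetric] by (simp add: case_prod_beta)
qed

text \<open>Self-adjointness moves \<open>B\<close> from the argument onto the vectors
  \<open>y n\<close>.\<close>

lemma nuclear_rep_comp:
  assumes rep: "nuclear_rep A x y" and B: "positive_op B"
  shows "nuclear_rep (A \<circ> B) x (\<lambda>n. B (y n))"
proof -
  obtain K where K: "0 \<le> K" "\<And>x. norm (B x) \<le> K * norm x"
    using bounded_clinear_op_bound[OF positive_op_bounded[OF B]] by blast
  have "summable (\<lambda>n. norm (x n) * norm (B (y n)))"
  proof (rule summable_comparison_test')
    show "summable (\<lambda>n. K * (norm (x n) * norm (y n)))"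
      using rep by (intro summable_mult) (simp add: nuclear_rep_def)
    show "norm (norm (x n) * norm (B (y n))) \<le> K * (norm (x n) * norm (y n))" for n
      using mult_left_mono[OF K(2)[of "y n"] norm_ge_zero[of "x n"]] by (simp add: algebra_simps)
  qed
  then show ?thesis
    using rep by (simp add: nuclear_rep_def positive_op_selfadjoint[OF B])
qed

lemma trace_comp:
  assumes "nuclear_rep A x y" "positive_op B"
  shows "trace (A \<circ> B) = (\<Sum>n. cinner (y n) (B (x n)))"
  using nuclear_rep_trace[OF nuclear_rep_comp[OF assms]]
  by (simp add: positive_op_selfadjoint[OF assms(2)])

text \<open>A Schur complement; its positivity is the Cauchy-Schwarz inequality for the form of
  \<open>A\<close> at \<open>z\<close> and \<open>a\<close>.\<close>

lemma positive_op_minus_rank_one: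
  fixes A :: "'h::chilbert_space \<Rightarrow> 'h"
  assumes A: "positive_op A" and c: "c = Re (cinner a (A a))" "0 < c"
  shows "positive_op (\<lambda>z. A z - (cinner (A a) z / complex_of_real c) *\<^sub>C A a)" (is "positive_op ?R")
proof -
  note lin = positive_op_add[OF A] positive_op_scaleC[OF A]
  have mlin: "k *\<^sub>C (u - v) = k *\<^sub>C u - k *\<^sub>C v" for k and u v :: 'h
    by (metis add_diff_cancel diff_add_cancel scaleC_add_right)
  obtain K where K: "0 \<le> K" "\<And>x. norm (A x) \<le> K * norm x"
    using bounded_clinear_op_bound[OF positive_op_bounded[OF A]] by blast
  have norm_scaleC: "norm (k *\<^sub>C u) = cmod k * norm u" for k and u :: 'h
  proof -
    have "complex_of_real ((norm (k *\<^sub>C u))\<^sup>2) = complex_of_real ((cmod k * norm u)\<^sup>2)"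
      unfolding cinner_self[symmetric] cinner_scaleC_left cinner_scaleC_right
      using complex_norm_square[of k] by (simp add: cinner_self power_mult_distrib)
    then show ?thesis
      by (metis of_real_eq_iff power2_eq_iff_nonneg mult_nonneg_nonneg norm_ge_zero)
  qed
  have "norm (?R z) \<le> norm z * (K + norm (A a) * norm (A a) / c)" for z
  proof -
    have "norm (?R z) \<le> norm (A z) + cmod (cinner (A a) z) / c * norm (A a)"
      using norm_triangle_ineq4[of "A z" "(cinner (A a) z / complex_of_real c) *\<^sub>C A a"] c(2)
      by (simp add: norm_scaleC norm_divide)
    also have "\<dots> \<le> K * norm z + norm (A a) * norm z / c * norm (A a)"
      using K c norm_cinner_le by (intro add_mono mult_right_mono divide_right_mono) auto
    finally show ?thesis
      by (simp add: algebra_simps)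
  qed
  then have "bounded_clinear_op ?R"
    unfolding bounded_clinear_op_def
    by (auto simp: lin cinner_simps add_divide_distrib scaleC_add_left mlin scaleC_scaleC)
  moreover have "Im (cinner z (?R z)) = 0 \<and> 0 \<le> Re (cinner z (?R z))" for z
  proof -
    have "cinner (A a) z * cinner z (A a) = complex_of_real ((cmod (cinner z (A a)))\<^sup>2)"
      using cinner_commute[of "A a" z] complex_norm_square[of "cinner z (A a)"]
      by (simp add: mult.commute)
    then have "cinner z (?R z) = cinner z (A z) - complex_of_real ((cmod (cinner z (A a)))\<^sup>2 / c)"
      by (simp add: cinner_simps)
    moreover have "(cmod (cinner z (A a)))\<^sup>2 / c \<le> Re (cinner z (A z))"
      using positive_op_Cauchy_Schwarz[OF A, of z a] c by (simp add: field_simps)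
    ultimately show ?thesis
      using positive_op_Im[OF A, of z] by simp
  qed
  ultimately show ?thesis
    unfolding positive_op_def by blast
qed

text \<open>Cholesky elimination: each step splits off a positive rank-one operator, for which the claim
  is positivity of \<open>B\<close>, and annihilates one more vector of \<open>E\<close>.\<close>
lemma compr_trace_nonneg:
  fixes A :: "'h::chilbert_space \<Rightarrow> 'h"
  assumes "finite E" "positive_op A" "positive_op B"
  shows "0 \<le> Re (compr_trace E A B)"
  using assms(2)
proof (induction "card {e\<in>E. A e \<noteq> 0}" arbitrary: A rule: less_induct)
  case (less A)
  show ?case
  proof (cases "\<exists>a\<in>E. A a \<noteq> 0")
    case False
    then show ?thesis
      by (simp add: compr_trace_def cinner_zero_right)
  next
    case True
    then obtain a where a: "a \<in> E" "A a \<noteq> 0"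
      by blast
    define c where "c = Re (cinner a (A a))"
    \<comment> \<open>Cauchy-Schwarz at \<open>A a\<close> and \<open>a\<close>: a vanishing
      \<open>c\<close> would make \<open>A a\<close> zero.\<close>
    have "c \<noteq> 0"
    proof
      assume "c = 0"
      then have "cinner (A a) (A a) = 0"
        using positive_op_Cauchy_Schwarz[OF less.prems, of "A a" a] by (simp add: c_def)
      with a show False
        by (simp add: cinner_eq_zero_iff)
    qed
    then have c: "0 < c"
      using positive_op_Re[OF less.prems, of a] by (simp add: c_def)
    have ca: "cinner a (A a) = complex_of_real c"
      using positive_op_Im[OF less.prems, of a] by (simp add: c_def complex_eq_iff)
    define R where "R = (\<lambda>z. A z - (cinner (A a) z / complex_of_real c) *\<^sub>C A a)"
    have R: "positive_op R"
      unfolding R_def by (rule positive_op_minus_rank_one[OF less.prems c_def c])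
    \<comment> \<open>No annihilated vector is lost and \<open>a\<close> is gained, so the measure
      of the induction strictly drops.\<close>
    have "R e = 0" if "A e = 0" for e
      using that positive_op_selfadjoint[OF less.prems, of a e]
      by (simp add: R_def cinner_zero_right scaleC_zero_left)
    moreover have "R a = 0"
      using c positive_op_selfadjoint[OF less.prems, of a a] by (simp add: R_def ca scaleC_one)
    ultimately have "{e\<in>E. R e \<noteq> 0} \<subset> {e\<in>E. A e \<noteq> 0}"
      using a by auto
    then have IH: "0 \<le> Re (compr_trace E R B)"
      by (intro less.hyps R psubset_card_mono) (use assms(1) in auto)
    have "cinner e (B f) * cinner f (A e) = cinner e (B f) * cinner f (R e) +
        cinner e (B f) * (cinner (A a) e * cinner f (A a)) / c" for e f
      using c by (simp add: R_def cinner_simps field_simps)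
    \<comment> \<open>The removed rank-one part contributes the form of \<open>B\<close> at
      \<open>proj E (A a)\<close>, divided by \<open>c\<close>.\<close>
    then have "compr_trace E A B = compr_trace E R B + cinner (proj E (A a)) (B (proj E (A a))) / c"
      unfolding cinner_proj_op_proj[OF positive_op_bounded[OF assms(3)]] compr_trace_def
      by (simp only: sum_divide_distrib sum.distrib)
    then show ?thesis
      using IH positive_op_Re[OF assms(3), of "proj E (A a)"] c by simp
  qed
qed

text \<open>The comparison is made on common compressions, where the first operator enters linearly,
  and then passed to the limit. Thus no nuclear representation of \<open>X - (T1 - T2)\<close> has
  to be built.\<close>

lemma trace_comp_le:
  fixes T1 :: "'h::chilbert_space \<Rightarrow> 'h"
  assumes "trace_class T1" "trace_class T2" "trace_class X"
    and "op_le (\<lambda>z. T1 z - T2 z) X" "positive_op B"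
  shows "Re (trace (T1 \<circ> B)) \<le> Re (trace (T2 \<circ> B)) + Re (trace (X \<circ> B))"
proof -
  obtain x1 y1 x2 y2 x3 y3 where
    r1: "nuclear_rep T1 x1 y1" and r2: "nuclear_rep T2 x2 y2" and r3: "nuclear_rep X x3 y3"
    using assms(1-3) unfolding trace_class_def by blast
  obtain E where E: "\<And>N. orthonormal (E N)"
    "\<And>N n z. z \<in> {x1, y1, x2, y2, x3, y3} \<Longrightarrow> n < N \<Longrightarrow> proj (E N) (z n) = z n"
    using orthonormal_exhaustion[of "{x1, y1, x2, y2, x3, y3}"] by auto
  note bB = positive_op_bounded[OF assms(5)]
  have lim: "(\<lambda>N. compr_trace (E N) T1 B) \<longlonglongrightarrow> trace (T1 \<circ> B)"
    "(\<lambda>N. compr_trace (E N) T2 B) \<longlonglongrightarrow> trace (T2 \<circ> B)" "(\<lambda>N. compr_trace (E N) X B) \<longlonglongrightarrow> trace (X \<circ> B)"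
    unfolding trace_comp[OF r1 assms(5)] trace_comp[OF r2 assms(5)] trace_comp[OF r3 assms(5)]
    by (rule compr_trace_tendsto[OF r1 bB E(1)] compr_trace_tendsto[OF r2 bB E(1)]
          compr_trace_tendsto[OF r3 bB E(1)];
        simp add: E(2))+
  have "Re (compr_trace (E N) T1 B) \<le> Re (compr_trace (E N) T2 B) + Re (compr_trace (E N) X B)" for N
  proof -
    have "0 \<le> Re (compr_trace (E N) (\<lambda>z. X z - (T1 z - T2 z)) B)"
      using assms(4,5) E(1)[of N] unfolding op_le_def orthonormal_def by (intro compr_trace_nonneg) auto
    also have "compr_trace (E N) (\<lambda>z. X z - (T1 z - T2 z)) B =
        compr_trace (E N) X B - (compr_trace (E N) T1 B - compr_trace (E N) T2 B)"
      unfolding compr_trace_def cinner_diff_right right_diff_distrib sum_subtractf ..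
    finally show ?thesis by simp
  qed
  then show ?thesis
    by (intro LIMSEQ_le[OF tendsto_Re[OF lim(1)] tendsto_add[OF tendsto_Re[OF lim(2)] tendsto_Re[OF lim(3)]]])
      auto
qed

text \<open>The case \<open>T - T \<le> T\<close> of the comparison.\<close>

lemma trace_comp_nonneg:
  fixes T :: "'h::chilbert_space \<Rightarrow> 'h"
  assumes "trace_class T" "positive_op T" "positive_op B"
  shows "0 \<le> Re (trace (T \<circ> B))"
proof -
  have "op_le (\<lambda>z. T z - T z) T"
    using assms(2) by (simp add: op_le_def)
  then show ?thesis
    using trace_comp_le[OF assms(1) assms(1) assms(1) _ assms(3)] by simp
qed

text \<open>Stated for a single representation, since \<open>trace_norm\<close> is an infimum and a
  nearly optimal representation can be inserted.\<close>

lemma Re_trace_le: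
  assumes "nuclear_rep X x y"
  shows "Re (trace X) \<le> (\<Sum>n. norm (x n) * norm (y n))"
proof -
  have sm: "summable (\<lambda>n. norm (x n) * norm (y n))"
    using assms by (simp add: nuclear_rep_def)
  have le: "norm (cinner (y n) (x n)) \<le> norm (x n) * norm (y n)" for n
    using norm_cinner_le[of "y n" "x n"] by (simp add: mult.commute)
  have "Re (trace X) \<le> norm (\<Sum>n. cinner (y n) (x n))"
    unfolding nuclear_rep_trace[OF assms] by (rule complex_Re_le_cmod)
  also have "\<dots> \<le> (\<Sum>n. norm (x n) * norm (y n))"
    by (rule norm_suminf_le[OF le sm])
  finally show ?thesis .
qed

section \<open>Operator-valued measures\<close>

lemma povm_positive: "is_povm U M \<Longrightarrow> A \<in> borel_sets_on U \<Longrightarrow> positive_op (M A)"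
  unfolding is_povm_def by blast

lemma povm_sums:
  assumes "is_povm U M" "range Bs \<subseteq> borel_sets_on U" "disjoint_family Bs"
  shows "(\<lambda>j. cinner x (M (Bs j) y)) sums cinner x (M (\<Union>j. Bs j) y)"
  using assms unfolding is_povm_def by blast

text \<open>The constant sequence of empty sets is disjoint, and a summable constant series has
  terms zero.\<close>

lemma povm_empty:
  assumes "is_povm U M"
  shows "cinner x (M {} y) = 0"
proof -
  have "(\<lambda>j::nat. cinner x (M {} y)) sums cinner x (M (\<Union>j::nat. {}) y)"
    by (rule povm_sums[OF assms]) (auto simp: disjoint_family_on_def)
  then show ?thesis
    using sums_summable summable_const_iff by blast
qed

lemma povm_finite_additive:
  fixes J :: nat
  assumes M: "is_povm U M" and Bs: "range Bs \<subseteq> borel_sets_on U" "disjoint_family Bs"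
  shows "(\<Sum>j<J. cinner x (M (Bs j) y)) = cinner x (M (\<Union>j<J. Bs j) y)"
proof -
  define Cs where "Cs j = (if j < J then Bs j else {})" for j :: nat
  have "(\<lambda>j. cinner x (M (Cs j) y)) sums cinner x (M (\<Union>j. Cs j) y)"
    using Bs by (intro povm_sums[OF M]) (auto simp: Cs_def disjoint_family_on_def)
  moreover have "(\<lambda>j. cinner x (M (Cs j) y)) sums (\<Sum>j<J. cinner x (M (Cs j) y))"
    by (rule sums_finite) (auto simp: Cs_def povm_empty[OF M])
  ultimately have "(\<Sum>j<J. cinner x (M (Cs j) y)) = cinner x (M (\<Union>j. Cs j) y)"
    by (rule sums_unique2[rotated])
  moreover have "(\<Union>j. Cs j) = (\<Union>j<J. Bs j)"
    by (auto simp: Cs_def split: if_splits)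
  ultimately show ?thesis
    by (simp add: Cs_def)
qed

text \<open>Additivity over \<open>A\<close> and \<open>U - A\<close> bounds the form of
  \<open>M A\<close> by that of the identity, and Cauchy-Schwarz extends the bound off the diagonal.
  Its independence of \<open>A\<close> is what the dominated convergence below requires.\<close>

lemma povm_norm_le:
  fixes M :: "'b::metric_space set \<Rightarrow> 'h::chilbert_space \<Rightarrow> 'h"
  assumes M: "is_povm U M" and A: "A \<in> borel_sets_on U"
  shows "cmod (cinner x (M A y)) \<le> norm x * norm y"
proof -
  have AU: "A \<subseteq> U" "U \<in> borel_sets_on U"
    using sets.sets_into_space[OF A] sets.top[of "restrict_space borel U"]
    by (auto simp: space_restrict_space)
  have le: "Re (cinner z (M A z)) \<le> (norm z)\<^sup>2" for z
  proof -
    define Bs where "Bs j = (if j = 0 then A else if j = 1 then U - A else {})" for j :: nat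
    have "(\<Sum>j<2. cinner z (M (Bs j) z)) = cinner z (M (\<Union>j<2. Bs j) z)"
      using A AU by (intro povm_finite_additive[OF M]) (auto simp: Bs_def disjoint_family_on_def)
    moreover have "(\<Union>j<2. Bs j) = U"
      using AU by (auto simp: Bs_def lessThan_nat_numeral lessThan_Suc)
    moreover have "M U = id"
      using M by (simp add: is_povm_def)
    ultimately have "cinner z (M A z) + cinner z (M (U - A) z) = cinner z z"
      by (simp add: Bs_def lessThan_nat_numeral lessThan_Suc add.commute)
    moreover have "0 \<le> Re (cinner z (M (U - A) z))"
      using A AU by (intro positive_op_Re povm_positive[OF M]) auto
    ultimately show ?thesis
      using cinner_self[of z] by (metis Re_complex_of_real plus_complex.sel(1) le_add_same_cancel1)
  qed
  have "(cmod (cinner x (M A y)))\<^sup>2 \<le> Re (cinner x (M A x)) * Re (cinner y (M A y))"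
    by (rule positive_op_Cauchy_Schwarz[OF povm_positive[OF M A]])
  also have "\<dots> \<le> (norm x)\<^sup>2 * (norm y)\<^sup>2"
    using positive_op_Re[OF povm_positive[OF M A]] by (intro mult_mono le) auto
  finally have "(cmod (cinner x (M A y)))\<^sup>2 \<le> (norm x * norm y)\<^sup>2"
    by (simp add: power_mult_distrib)
  then show ?thesis
    by (rule power2_le_imp_le) simp
qed

text \<open>Weak additivity controls each term of the nuclear series. Partial sums over
  \<open>j\<close> are values of \<open>M\<close> at finite unions, hence contractive, so the
  nuclear series dominates uniformly in \<open>J\<close>.\<close>

lemma povm_trace_sums:
  assumes M: "is_povm U M" and T: "trace_class T"
    and Bs: "range Bs \<subseteq> borel_sets_on U" "disjoint_family Bs"
  shows "(\<lambda>j. trace (T \<circ> M (Bs j))) sums trace (T \<circ> M (\<Union>j. Bs j))"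
proof -
  obtain x y where rep: "nuclear_rep T x y"
    using T unfolding trace_class_def by blast
  have B: "Bs j \<in> borel_sets_on U" for j
    using Bs by auto
  have UB: "(\<Union>j. Bs j) \<in> borel_sets_on U"
    using B by blast
  have UBf: "(\<Union>j<J. Bs j) \<in> borel_sets_on U" for J
    using B by blast
  have "(\<lambda>J. \<Sum>n. \<Sum>j<J. cinner (y n) (M (Bs j) (x n))) \<longlonglongrightarrow>
      (\<Sum>n. cinner (y n) (M (\<Union>j. Bs j) (x n)))"
  proof (rule tannerys_theorem[THEN conjunct2, THEN conjunct2])
    show "(\<lambda>J. \<Sum>j<J. cinner (y n) (M (Bs j) (x n))) \<longlonglongrightarrow> cinner (y n) (M (\<Union>j. Bs j) (x n))" for n
      using povm_sums[OF M Bs] unfolding sums_def .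
    show "summable (\<lambda>n. norm (x n) * norm (y n))"
      using rep by (simp add: nuclear_rep_def)
    have "norm (cinner (y n) (M (\<Union>j<J. Bs j) (x n))) \<le> norm (x n) * norm (y n)" for n J
      using povm_norm_le[OF M UBf, of "y n" J "x n"] by (simp add: mult.commute)
    then show "\<forall>\<^sub>F (n, J) in sequentially \<times>\<^sub>F sequentially.
        norm (\<Sum>j<J. cinner (y n) (M (Bs j) (x n))) \<le> norm (x n) * norm (y n)"
      unfolding povm_finite_additive[OF M Bs]
      by (auto intro!: always_eventually)
  qed simp
  moreover have "(\<Sum>n. \<Sum>j<J. cinner (y n) (M (Bs j) (x n))) = (\<Sum>j<J. trace (T \<circ> M (Bs j)))" for J
    unfolding trace_comp[OF rep povm_positive[OF M B]]
    by (intro suminf_sum nuclear_rep_summable[OF rep] positive_op_bounded povm_positive[OF M B])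
  ultimately show ?thesis
    unfolding sums_def trace_comp[OF rep povm_positive[OF M UB]] by simp
qed

lemma space_povm_measure: "space (povm_measure U T M) = U"
  and sets_povm_measure: "sets (povm_measure U T M) = borel_sets_on U"
proof -
  have "sigma_algebra U (borel_sets_on U)"
    using sets.sigma_algebra_axioms[of "restrict_space borel U"] by (simp add: space_restrict_space)
  then show "space (povm_measure U T M) = U" "sets (povm_measure U T M) = borel_sets_on U"
    unfolding povm_measure_def
    by (simp_all add: sigma_algebra.sets_measure_of_eq sigma_algebra.space_measure_of_eq)
qed

text \<open>\<open>measure_of\<close> yields the zero measure unless its set function is a measure;
  nonnegativity and countable additivity of the traces ensure that the intended values are
  taken.\<close>

lemma
  assumes M: "is_povm U M" and T: "trace_class T" "positive_op T"
  shows measure_povm_measure: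
      "\<And>A. A \<in> borel_sets_on U \<Longrightarrow> measure (povm_measure U T M) A = Re (trace (T \<circ> M A))"
    and finite_povm_measure: "finite_measure (povm_measure U T M)"
proof -
  have nn: "0 \<le> Re (trace (T \<circ> M A))" if "A \<in> borel_sets_on U" for A
    by (rule trace_comp_nonneg[OF T povm_positive[OF M that]])
  have sa: "sigma_algebra U (borel_sets_on U)"
    using sets.sigma_algebra_axioms[of "restrict_space borel U"] by (simp add: space_restrict_space)
  have add: "(\<Sum>i. ennreal (Re (trace (T \<circ> M (Bs i))))) = ennreal (Re (trace (T \<circ> M (\<Union>i. Bs i))))"
    if "range Bs \<subseteq> borel_sets_on U" "disjoint_family Bs" for Bs :: "nat \<Rightarrow> _"
    by (rule suminf_ennreal_eq) (use that nn sums_Re[OF povm_trace_sums[OF M T(1) that]] in auto)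
  obtain x y where rep: "nuclear_rep T x y"
    using T unfolding trace_class_def by blast
  have "trace (T \<circ> M {}) = 0"
    using trace_comp[OF rep povm_positive[OF M, of "{}"]] povm_empty[OF M] by simp
  then have em: "emeasure (povm_measure U T M) A = ennreal (Re (trace (T \<circ> M A)))"
    if "A \<in> borel_sets_on U" for A
    unfolding povm_measure_def
    by (intro emeasure_measure_of_sigma[OF sa _ _ that])
      (use add in \<open>auto simp: positive_def countably_additive_def\<close>)
  then show "measure (povm_measure U T M) A = Re (trace (T \<circ> M A))" if "A \<in> borel_sets_on U" for A
    using that nn by (simp add: measure_def)
  have "U \<in> borel_sets_on U"
    using sets.top[of "restrict_space borel U"] by (simp add: space_restrict_space)
  then show "finite_measure (povm_measure U T M)"
    by (intro finite_measureI) (simp add: space_povm_measure em)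
qed

section \<open>Convex combinations of POVMs\<close>

lemma positive_op_combination:
  assumes A: "positive_op A" and B: "positive_op B" and ab: "0 \<le> a" "0 \<le> b"
  shows "positive_op (\<lambda>z. a *\<^sub>R A z + b *\<^sub>R B z)"
proof -
  obtain K where K: "0 \<le> K" "\<And>x. norm (A x) \<le> K * norm x"
    using bounded_clinear_op_bound[OF positive_op_bounded[OF A]] by blast
  obtain L where L: "0 \<le> L" "\<And>x. norm (B x) \<le> L * norm x"
    using bounded_clinear_op_bound[OF positive_op_bounded[OF B]] by blast
  have "norm (a *\<^sub>R A z + b *\<^sub>R B z) \<le> norm z * (a * K + b * L)" for z
  proof -
    have "norm (a *\<^sub>R A z + b *\<^sub>R B z) \<le> a * norm (A z) + b * norm (B z)"
      using norm_triangle_ineq[of "a *\<^sub>R A z" "b *\<^sub>R B z"] ab by simp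
    also have "\<dots> \<le> a * (K * norm z) + b * (L * norm z)"
      using ab K L by (intro add_mono mult_left_mono) auto
    finally show ?thesis by (simp add: algebra_simps)
  qed
  then have "bounded_clinear_op (\<lambda>z. a *\<^sub>R A z + b *\<^sub>R B z)"
    unfolding bounded_clinear_op_def
    by (intro conjI exI[of _ "a * K + b * L"])
      (auto simp: positive_op_add[OF A] positive_op_add[OF B] positive_op_scaleC[OF A]
        positive_op_scaleC[OF B] scaleR_scaleC scaleC_add_right scaleC_scaleC mult.commute)
  then show ?thesis
    using positive_op_Im[OF A] positive_op_Im[OF B] positive_op_Re[OF A] positive_op_Re[OF B] ab
    unfolding positive_op_def by (auto simp: cinner_simps)
qed

lemma povm_convex:
  assumes "is_povm U M1" "is_povm U M2" "0 \<le> t" "t \<le> 1"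
  shows "is_povm U (\<lambda>A z. t *\<^sub>R M1 A z + (1 - t) *\<^sub>R M2 A z)"
  unfolding is_povm_def
proof (intro conjI ballI allI impI)
  show "positive_op (\<lambda>z. t *\<^sub>R M1 B z + (1 - t) *\<^sub>R M2 B z)" if "B \<in> borel_sets_on U" for B
    using assms that by (intro positive_op_combination povm_positive) auto
  show "(\<lambda>j. cinner x (t *\<^sub>R M1 (Bs j) y + (1 - t) *\<^sub>R M2 (Bs j) y)) sums
      cinner x (t *\<^sub>R M1 (\<Union>j. Bs j) y + (1 - t) *\<^sub>R M2 (\<Union>j. Bs j) y)"
    if "range Bs \<subseteq> borel_sets_on U \<and> disjoint_family Bs" for Bs :: "nat \<Rightarrow> _" and x y
    unfolding cinner_add_right cinner_scaleR_right
    using that by (intro sums_add sums_mult povm_sums[OF assms(1)] povm_sums[OF assms(2)]) auto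
  show "(\<lambda>z. t *\<^sub>R M1 U z + (1 - t) *\<^sub>R M2 U z) = id"
    using assms by (auto simp: is_povm_def fun_eq_iff simp flip: scaleR_add_left)
qed

lemma trace_comp_combination:
  assumes T: "trace_class T" and A: "positive_op A" and B: "positive_op B" and ab: "0 \<le> a" "0 \<le> b"
  shows "Re (trace (T \<circ> (\<lambda>z. a *\<^sub>R A z + b *\<^sub>R B z))) =
    a * Re (trace (T \<circ> A)) + b * Re (trace (T \<circ> B))"
proof -
  obtain x y where rep: "nuclear_rep T x y"
    using T unfolding trace_class_def by blast
  note sm = nuclear_rep_summable[OF rep positive_op_bounded[OF A]]
    nuclear_rep_summable[OF rep positive_op_bounded[OF B]]
  have "trace (T \<circ> (\<lambda>z. a *\<^sub>R A z + b *\<^sub>R B z)) =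
      (\<Sum>n. complex_of_real a * cinner (y n) (A (x n)) + complex_of_real b * cinner (y n) (B (x n)))"
    unfolding trace_comp[OF rep positive_op_combination[OF A B ab]] cinner_add_right
      cinner_scaleR_right ..
  also have "\<dots> = complex_of_real a * trace (T \<circ> A) + complex_of_real b * trace (T \<circ> B)"
    unfolding trace_comp[OF rep A] trace_comp[OF rep B]
    using sm by (simp add: suminf_add[symmetric] suminf_mult summable_mult)
  finally show ?thesis by simp
qed

section \<open>Risk functions\<close>

lemma risk_nonneg:
  assumes "\<And>u. u \<in> U \<Longrightarrow> 0 \<le> w (\<theta>, u)"
  shows "0 \<le> risk U \<rho> w M \<theta>"
  unfolding risk_def using assms by (intro integral_nonneg_AE AE_I2) (simp add: space_povm_measure)

text \<open>Traces are affine in the POVM, so the measures combine exactly. The inequality suffices,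
  because the family of functions built from the risks is closed upwards.\<close>

lemma risk_convex:
  fixes w :: "'a \<times> 'b::metric_space \<Rightarrow> real"
  assumes M: "is_povm U M1" "is_povm U M2" and t: "0 \<le> t" "t \<le> 1"
    and T: "trace_class (\<rho> \<theta>)" "positive_op (\<rho> \<theta>)"
    and w: "continuous_on U (\<lambda>u. w (\<theta>, u))"
    and w0: "\<And>u. u \<in> U \<Longrightarrow> 0 \<le> w (\<theta>, u)" and wC: "\<And>u. u \<in> U \<Longrightarrow> w (\<theta>, u) \<le> C"
  shows "risk U \<rho> w (\<lambda>A z. t *\<^sub>R M1 A z + (1 - t) *\<^sub>R M2 A z) \<theta> \<le>
    t * risk U \<rho> w M1 \<theta> + (1 - t) * risk U \<rho> w M2 \<theta>"
  unfolding risk_def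
proof (rule integral_le_combination)
  show "(\<lambda>u. w (\<theta>, u)) \<in> borel_measurable
      (povm_measure U (\<rho> \<theta>) (\<lambda>A z. t *\<^sub>R M1 A z + (1 - t) *\<^sub>R M2 A z))"
    using borel_measurable_continuous_on_restrict[OF w]
    by (simp add: measurable_cong_sets[OF sets_povm_measure refl])
  fix A assume "A \<in> sets (povm_measure U (\<rho> \<theta>) (\<lambda>A z. t *\<^sub>R M1 A z + (1 - t) *\<^sub>R M2 A z))"
  then have A: "A \<in> borel_sets_on U"
    by (simp add: sets_povm_measure)
  show "measure (povm_measure U (\<rho> \<theta>) (\<lambda>A z. t *\<^sub>R M1 A z + (1 - t) *\<^sub>R M2 A z)) A \<le>
      t * measure (povm_measure U (\<rho> \<theta>) M1) A + (1 - t) * measure (povm_measure U (\<rho> \<theta>) M2) A"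
    using trace_comp_combination[OF T(1) povm_positive[OF M(1) A] povm_positive[OF M(2) A], of t "1 - t"] t
    by (simp add: measure_povm_measure[OF _ T A] M povm_convex[OF M t])
qed (use t w0 wC in \<open>auto simp: sets_povm_measure space_povm_measure finite_povm_measure[OF _ T] M
    povm_convex[OF M t]\<close>)

text \<open>Half of \<open>\<epsilon>\<close> pays for moving the loss, by uniform continuity, and
  half for moving the state, by regularity. Neither \<open>d\<close> nor \<open>X\<close> depends on
  \<open>M\<close>, hence the uniformity.\<close>

lemma risk_equicontinuous:
  fixes \<Theta> :: "'a::metric_space set" and U :: "'b::metric_space set"
    and \<rho> :: "'a \<Rightarrow> 'h::chilbert_space \<Rightarrow> 'h" and w :: "'a \<times> 'b \<Rightarrow> real"
  assumes cpt: "compact \<Theta>" "compact U" and \<rho>: "quantum_model \<Theta> \<rho>"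
    and w: "continuous_on (\<Theta> \<times> U) w"
    and w0: "\<And>p. p \<in> \<Theta> \<times> U \<Longrightarrow> 0 \<le> w p" and wC: "\<And>p. p \<in> \<Theta> \<times> U \<Longrightarrow> w p \<le> C"
    and "0 < \<epsilon>"
  shows "\<exists>\<delta>>0. \<forall>M\<in>Povm U. \<forall>\<theta>\<in>\<Theta>. \<forall>\<eta>\<in>\<Theta>. dist \<theta> \<eta> < \<delta> \<longrightarrow>
    risk U \<rho> w M \<theta> \<le> risk U \<rho> w M \<eta> + \<epsilon>"
proof -
  \<comment> \<open>A strictly positive bound, as it occurs in a denominator.\<close>
  define D where "D = \<bar>C\<bar> + 1"
  have wD: "w p \<le> D" if "p \<in> \<Theta> \<times> U" for p
    using wC[OF that] by (simp add: D_def)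
  have D: "0 < D" by (simp add: D_def)
  have "uniformly_continuous_on (\<Theta> \<times> U) w"
    using w cpt by (intro compact_uniformly_continuous compact_Times)
  then obtain d where d: "0 < d"
    "\<And>p q. p \<in> \<Theta> \<times> U \<Longrightarrow> q \<in> \<Theta> \<times> U \<Longrightarrow> dist q p < d \<Longrightarrow> dist (w q) (w p) < \<epsilon> / 2"
    using \<open>0 < \<epsilon>\<close> unfolding uniformly_continuous_on_def by (metis half_gt_zero)
  have state: "trace_class (\<rho> \<theta>)" "positive_op (\<rho> \<theta>)" "trace (\<rho> \<theta>) = 1" if "\<theta> \<in> \<Theta>" for \<theta>
    using \<rho> that unfolding quantum_model_def by auto
  \<comment> \<open>Regularity is applied to the compact set \<open>\<Theta>\<close> itself.\<close>
  have "((\<lambda>\<delta>. omega \<rho> \<Theta> \<delta>) \<longlongrightarrow> 0) (at_right 0)"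
    using \<rho> cpt unfolding quantum_model_def regular_def by auto
  then have "\<forall>\<^sub>F \<delta> in at_right 0. omega \<rho> \<Theta> \<delta> < ereal (\<epsilon> / (2 * D))"
    using \<open>0 < \<epsilon>\<close> D by (intro order_tendstoD(2)) auto
  then obtain b where b: "0 < b" "\<And>\<delta>. 0 < \<delta> \<Longrightarrow> \<delta> < b \<Longrightarrow> omega \<rho> \<Theta> \<delta> < ereal (\<epsilon> / (2 * D))"
    unfolding eventually_at_right_field by auto
  define r where "r = b / 2"
  have r: "0 < r" "omega \<rho> \<Theta> r < ereal (\<epsilon> / (2 * D))"
    using b by (auto simp: r_def)
  then obtain X where X: "trace_class X" "trace_norm X < \<epsilon> / (2 * D)"
    and Xle: "\<And>\<theta> \<eta>. \<theta> \<in> \<Theta> \<Longrightarrow> \<eta> \<in> \<Theta> \<Longrightarrow> dist \<theta> \<eta> < r \<Longrightarrow> op_le (\<lambda>z. \<rho> \<theta> z - \<rho> \<eta> z) X"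
    unfolding omega_def Inf_less_iff Kdelta_def by auto
  obtain x y where xy: "nuclear_rep X x y" "(\<Sum>n. norm (x n) * norm (y n)) < \<epsilon> / (2 * D)"
  proof -
    have "{(\<Sum>n. norm (x n) * norm (y n)) | x y. nuclear_rep X x y} \<noteq> {}"
      using X(1) unfolding trace_class_def by blast
    from cInf_lessD[OF this X(2)[unfolded trace_norm_def]] show ?thesis
      using that by blast
  qed
  have trX: "Re (trace X) \<le> \<epsilon> / (2 * D)"
    using Re_trace_le[OF xy(1)] xy(2) by simp
  have main: "risk U \<rho> w M \<theta> \<le> risk U \<rho> w M \<eta> + \<epsilon>"
    if M: "M \<in> Povm U" and \<theta>: "\<theta> \<in> \<Theta>" and \<eta>: "\<eta> \<in> \<Theta>" and dist: "dist \<theta> \<eta> < min d r" for M \<theta> \<eta>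
  proof -
    have pM: "is_povm U M"
      using M by (simp add: Povm_def)
    have MU: "M U = id" "U \<in> borel_sets_on U"
      using pM sets.top[of "restrict_space borel U"] by (auto simp: is_povm_def space_restrict_space)
    \<comment> \<open>Taking both parameters equal gives \<open>0 \<le> X\<close>, so
      \<open>X\<close> induces a finite measure of its own.\<close>
    have Xpos: "positive_op X"
      using Xle[OF \<theta> \<theta>] r by (simp add: op_le_def)
    have meas: "(\<lambda>u. w (\<zeta>, u)) \<in> borel_measurable (povm_measure U T M)" if "\<zeta> \<in> \<Theta>" for \<zeta> and T :: "'h \<Rightarrow> 'h"
    proof -
      have "continuous_on U (\<lambda>u. w (\<zeta>, u))"
        using that by (intro continuous_on_compose2[OF w] continuous_intros) auto
      then show ?thesis
        using borel_measurable_continuous_on_restrict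
        by (simp add: measurable_cong_sets[OF sets_povm_measure refl])
    qed
    let ?\<mu> = "\<lambda>T. povm_measure U T M"
    interpret \<eta>: finite_measure "?\<mu> (\<rho> \<eta>)"
      by (rule finite_povm_measure[OF pM state(1,2)[OF \<eta>]])
    interpret X: finite_measure "?\<mu> X"
      by (rule finite_povm_measure[OF pM X(1) Xpos])
    have int: "integrable (?\<mu> (\<rho> \<eta>)) (\<lambda>u. w (\<zeta>, u))" "integrable (?\<mu> X) (\<lambda>u. w (\<zeta>, u))"
      if "\<zeta> \<in> \<Theta>" for \<zeta>
      using that w0 wD meas[OF that]
      by (auto intro!: \<eta>.integrable_const_bound[of _ D] X.integrable_const_bound[of _ D]
          simp: space_povm_measure)
    \<comment> \<open>The measure at \<open>\<theta>\<close> is dominated by the sum of those at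
      \<open>\<eta>\<close> and of \<open>X\<close>. The first integral then has its loss moved to
      \<open>\<eta>\<close>, the second is bounded by \<open>D\<close> times the mass of
      \<open>X\<close>.\<close>
    have "risk U \<rho> w M \<theta> \<le> 1 * (\<integral>u. w (\<theta>, u) \<partial>?\<mu> (\<rho> \<eta>)) + 1 * (\<integral>u. w (\<theta>, u) \<partial>?\<mu> X)"
      unfolding risk_def
    proof (rule integral_le_combination[where C = D])
      show "finite_measure (?\<mu> (\<rho> \<theta>))"
        by (rule finite_povm_measure[OF pM state(1,2)[OF \<theta>]])
      fix A assume "A \<in> sets (?\<mu> (\<rho> \<theta>))"
      then have A: "A \<in> borel_sets_on U"
        by (simp add: sets_povm_measure)
      show "measure (?\<mu> (\<rho> \<theta>)) A \<le> 1 * measure (?\<mu> (\<rho> \<eta>)) A + 1 * measure (?\<mu> X) A"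
        using trace_comp_le[OF state(1)[OF \<theta>] state(1)[OF \<eta>] X(1) Xle[OF \<theta> \<eta>] povm_positive[OF pM A]]
          dist measure_povm_measure[OF pM state(1,2)[OF \<theta>] A]
          measure_povm_measure[OF pM state(1,2)[OF \<eta>] A] measure_povm_measure[OF pM X(1) Xpos A]
        by simp
    qed (use \<theta> meas[OF \<theta>] w0 wD \<eta>.finite_measure_axioms X.finite_measure_axioms in
        \<open>auto simp: sets_povm_measure space_povm_measure\<close>)
    also have "(\<integral>u. w (\<theta>, u) \<partial>?\<mu> (\<rho> \<eta>)) \<le> (\<integral>u. w (\<eta>, u) + \<epsilon> / 2 \<partial>?\<mu> (\<rho> \<eta>))"
    proof (rule integral_mono)
      fix u assume "u \<in> space (?\<mu> (\<rho> \<eta>))"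
      then have "dist (w (\<theta>, u)) (w (\<eta>, u)) < \<epsilon> / 2"
        using \<theta> \<eta> dist by (intro d(2)) (auto simp: space_povm_measure dist_Pair_Pair)
      then show "w (\<theta>, u) \<le> w (\<eta>, u) + \<epsilon> / 2"
        unfolding dist_real_def by linarith
    qed (use int \<theta> \<eta> in auto)
    \<comment> \<open>The state has trace one and \<open>M U = id\<close>, so the constant
      integrates to itself.\<close>
    also have "\<dots> = risk U \<rho> w M \<eta> + \<epsilon> / 2"
      using int(1)[OF \<eta>] measure_povm_measure[OF pM state(1,2)[OF \<eta>] MU(2)] state(3)[OF \<eta>]
      by (simp add: risk_def space_povm_measure MU(1))
    also have "(\<integral>u. w (\<theta>, u) \<partial>?\<mu> X) \<le> (\<integral>u. D \<partial>?\<mu> X)"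
      using int(2)[OF \<theta>] wD \<theta> by (intro integral_mono) (auto simp: space_povm_measure)
    also have "\<dots> = D * Re (trace X)"
      using measure_povm_measure[OF pM X(1) Xpos MU(2)] by (simp add: space_povm_measure MU(1))
    also have "\<dots> \<le> \<epsilon> / 2"
      using mult_left_mono[OF trX less_imp_le[OF D]] D by simp
    finally show ?thesis by simp
  qed
  show ?thesis
    using d(1) r(1) main by (intro exI[of _ "min d r"]) auto
qed

theorem theorem2:
  fixes \<Theta> :: "'a::metric_space set" and U :: "'b::metric_space set"
    and \<rho> :: "'a \<Rightarrow> 'h::chilbert_space \<Rightarrow> 'h" and w :: "'a \<times> 'b \<Rightarrow> real"
  assumes "compact \<Theta>" and "\<Theta> \<noteq> {}" and "compact U"
    and "quantum_model \<Theta> \<rho>"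
    and "continuous_on (\<Theta> \<times> U) w"
    and "bounded (w ` (\<Theta> \<times> U))"
    and "\<forall>p \<in> \<Theta> \<times> U. 0 \<le> w p"
  shows "(INF M \<in> Povm U. SUP \<theta> \<in> \<Theta>. ereal (risk U \<rho> w M \<theta>)) =
         (SUP \<pi> \<in> prob_measures \<Theta>. INF M \<in> Povm U. ereal (\<integral>\<theta>. risk U \<rho> w M \<theta> \<partial>\<pi>))"
proof (rule antisym)
  let ?R = "risk U \<rho> w"
  obtain C where C: "w p \<le> C" if "p \<in> \<Theta> \<times> U" for p
    using assms(6) unfolding bounded_iff by (auto simp: abs_le_iff)
  have w0: "0 \<le> w p" if "p \<in> \<Theta> \<times> U" for p
    using assms(7) that by blast
  have w\<theta>: "continuous_on U (\<lambda>u. w (\<theta>, u))" if "\<theta> \<in> \<Theta>" for \<theta>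
    using that by (intro continuous_on_compose2[OF assms(5)] continuous_intros) auto
  note equi = risk_equicontinuous[OF assms(1,3,4,5) w0 C]
  show "(INF M \<in> Povm U. SUP \<theta> \<in> \<Theta>. ereal (?R M \<theta>)) \<le>
      (SUP \<pi> \<in> prob_measures \<Theta>. INF M \<in> Povm U. ereal (\<integral>\<theta>. ?R M \<theta> \<partial>\<pi>))" (is "?lhs \<le> ?rhs")
  proof (rule dense_le)
    fix x assume "x < ?lhs"
    \<comment> \<open>The gap between \<open>v\<close> and \<open>v'\<close> is what may be lost in
      passing from \<open>\<Theta>\<close> to a finite net.\<close>
    then obtain v' where v': "x < ereal v'" "ereal v' < ?lhs"
      using ereal_dense2 by blast
    then obtain v where v: "x < ereal v" "v < v'"
      using ereal_dense2[OF v'(1)] by auto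
    obtain \<delta> where \<delta>: "0 < \<delta>" "\<And>M \<theta> \<eta>. M \<in> Povm U \<Longrightarrow> \<theta> \<in> \<Theta> \<Longrightarrow> \<eta> \<in> \<Theta> \<Longrightarrow> dist \<theta> \<eta> < \<delta> \<Longrightarrow>
        ?R M \<theta> \<le> ?R M \<eta> + (v' - v)"
      using equi[of "v' - v"] v by auto
    obtain F where F: "finite F" "F \<subseteq> \<Theta>" "\<Theta> \<subseteq> (\<Union>\<eta>\<in>F. ball \<eta> \<delta>)"
      using seq_compact_imp_totally_bounded assms(1) \<delta>(1) compact_eq_seq_compact_metric by metis
    have "F \<noteq> {}"
      using F(3) assms(2) by auto
    \<comment> \<open>closed upwards, so that convexity of the risk in \<open>M\<close> makes it a convex set\<close>
    define \<Phi> where "\<Phi> = {g. \<exists>M\<in>Povm U. \<forall>i\<in>F. ?R M i \<le> g i}"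
    have "\<exists>p. (\<forall>i\<in>F. 0 \<le> p i) \<and> sum p F = 1 \<and> (\<forall>f\<in>\<Phi>. v \<le> (\<Sum>i\<in>F. p i * f i))"
    proof (rule finite_minimax[OF F(1) \<open>F \<noteq> {}\<close>])
      fix f g and t :: real assume "f \<in> \<Phi>" "g \<in> \<Phi>" and t: "0 \<le> t" "t \<le> 1"
      then obtain M1 M2 where M: "is_povm U M1" "is_povm U M2"
          and fg: "\<And>i. i \<in> F \<Longrightarrow> ?R M1 i \<le> f i" "\<And>i. i \<in> F \<Longrightarrow> ?R M2 i \<le> g i"
        by (auto simp: \<Phi>_def Povm_def)
      have "?R (\<lambda>A z. t *\<^sub>R M1 A z + (1 - t) *\<^sub>R M2 A z) i \<le> t * f i + (1 - t) * g i" if "i \<in> F" for i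
      proof -
        have i: "i \<in> \<Theta>" using that F by auto
        have "?R (\<lambda>A z. t *\<^sub>R M1 A z + (1 - t) *\<^sub>R M2 A z) i \<le> t * ?R M1 i + (1 - t) * ?R M2 i"
          using i assms(4) w0 C
          by (intro risk_convex[OF M t _ _ w\<theta>[OF i]]) (auto simp: quantum_model_def)
        also have "\<dots> \<le> t * f i + (1 - t) * g i"
          using fg[OF that] t by (intro add_mono mult_left_mono) auto
        finally show ?thesis .
      qed
      then show "(\<lambda>i. t * f i + (1 - t) * g i) \<in> \<Phi>"
        using povm_convex[OF M t] unfolding \<Phi>_def Povm_def by blast
    next
      fix g assume "g \<in> \<Phi>"
      then obtain M where M: "M \<in> Povm U" "\<And>i. i \<in> F \<Longrightarrow> ?R M i \<le> g i"
        by (auto simp: \<Phi>_def)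
      \<comment> \<open>Some parameter has risk above \<open>v'\<close>; a net point within
        \<open>\<delta>\<close> of it still has risk at least \<open>v\<close>.\<close>
      have "ereal v' < (SUP \<theta> \<in> \<Theta>. ereal (?R M \<theta>))"
        using v'(2) M(1) by (meson INF_lower order.strict_trans2)
      then obtain \<theta> where \<theta>: "\<theta> \<in> \<Theta>" "v' < ?R M \<theta>"
        unfolding less_SUP_iff by auto
      then obtain i where i: "i \<in> F" "dist \<theta> i < \<delta>"
        using F(3) by (auto simp: dist_commute)
      then show "\<exists>i\<in>F. v \<le> g i"
        using \<delta>(2)[OF M(1) \<theta>(1), of i] M(2)[of i] \<theta>(2) F(2) by (intro bexI[of _ i]) auto
    qed
    then obtain p where p: "\<And>i. i \<in> F \<Longrightarrow> 0 \<le> p i" "sum p F = 1"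
        "\<And>f. f \<in> \<Phi> \<Longrightarrow> v \<le> (\<Sum>i\<in>F. p i * f i)"
      by auto
    obtain \<pi> where \<pi>: "\<pi> \<in> prob_measures \<Theta>"
        "\<And>f::'a \<Rightarrow> real. f \<in> borel_measurable (restrict_space borel \<Theta>) \<Longrightarrow>
          (\<integral>\<theta>. f \<theta> \<partial>\<pi>) = (\<Sum>i\<in>F. p i * f i)"
      using finite_prob_measure[OF F(1,2) p(1,2)] by metis
    have "x \<le> ereal (\<integral>\<theta>. ?R M \<theta> \<partial>\<pi>)" if M: "M \<in> Povm U" for M
    proof -
      \<comment> \<open>Equicontinuity used in both directions; continuity supplies the
        measurability under which \<open>\<pi>\<close> integrates as a finite sum.\<close>
      have "continuous_on \<Theta> (?R M)"
        unfolding continuous_on_iff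
      proof (intro ballI allI impI)
        fix \<theta> and e :: real assume \<theta>: "\<theta> \<in> \<Theta>" and "0 < e"
        then obtain d where d: "0 < d" "\<And>\<theta> \<eta>. \<theta> \<in> \<Theta> \<Longrightarrow> \<eta> \<in> \<Theta> \<Longrightarrow> dist \<theta> \<eta> < d \<Longrightarrow>
            ?R M \<theta> \<le> ?R M \<eta> + e / 2"
          using equi[of "e / 2"] M by auto
        have "dist (?R M \<eta>) (?R M \<theta>) < e" if "\<eta> \<in> \<Theta>" "dist \<eta> \<theta> < d" for \<eta>
          using d(2)[OF that(1) \<theta> that(2)] d(2)[OF \<theta> that(1)] that(2) \<open>0 < e\<close>
          by (simp add: dist_commute dist_real_def abs_less_iff)
        with d(1) show "\<exists>d>0. \<forall>\<eta>\<in>\<Theta>. dist \<eta> \<theta> < d \<longrightarrow> dist (?R M \<eta>) (?R M \<theta>) < e"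
          by blast
      qed
      then have "(\<integral>\<theta>. ?R M \<theta> \<partial>\<pi>) = (\<Sum>i\<in>F. p i * ?R M i)"
        by (intro \<pi>(2) borel_measurable_continuous_on_restrict)
      also have "v \<le> \<dots>"
        \<comment> \<open>The risk function of \<open>M\<close> itself belongs to
          \<open>\<Phi>\<close>.\<close>
        using M by (intro p(3)) (auto simp: \<Phi>_def)
      finally show ?thesis
        using v(1) by (metis ereal_less_eq(3) less_imp_le order_trans)
    qed
    then show "x \<le> ?rhs"
      using \<pi>(1) by (intro SUP_upper2[of \<pi>] INF_greatest)
  qed
  show "?rhs \<le> ?lhs"
  proof (intro SUP_least INF_greatest)
    fix \<pi> and M :: "'b set \<Rightarrow> 'h \<Rightarrow> 'h"
    assume \<pi>: "\<pi> \<in> prob_measures \<Theta>" and M: "M \<in> Povm U"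
    interpret prob_space \<pi>
      using \<pi> by (simp add: prob_measures_def)
    have sp: "space \<pi> = \<Theta>"
      using \<pi> sets_eq_imp_space_eq[of \<pi> "restrict_space borel \<Theta>"]
      by (simp add: prob_measures_def space_restrict_space)
    obtain \<theta>0 where \<theta>0: "\<theta>0 \<in> \<Theta>"
      using assms(2) by blast
    \<comment> \<open>A nonintegrable risk function has integral 0 by convention, so nonnegativity
      of a real bound, read off at \<open>\<theta>0\<close>, covers that case.\<close>
    have "ereal (\<integral>\<theta>. ?R M \<theta> \<partial>\<pi>) \<le> s" if s: "\<And>\<theta>. \<theta> \<in> \<Theta> \<Longrightarrow> ereal (?R M \<theta>) \<le> s" for s
    proof (cases s)
      case (real r)
      have "0 \<le> r"
        using s[OF \<theta>0] risk_nonneg[of U w \<theta>0 \<rho> M] w0 \<theta>0 real by auto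
      then have "(\<integral>\<theta>. ?R M \<theta> \<partial>\<pi>) \<le> r"
        using s sp real
        by (cases "integrable \<pi> (?R M)") (auto intro!: integral_le_const simp: not_integrable_integral_eq)
      then show ?thesis
        by (simp add: real)
    next
      case MInf
      then show ?thesis
        using s[OF \<theta>0] by simp
    qed simp
    then have "ereal (\<integral>\<theta>. ?R M \<theta> \<partial>\<pi>) \<le> (SUP \<theta> \<in> \<Theta>. ereal (?R M \<theta>))"
      by (meson SUP_upper)
    then show "(INF M \<in> Povm U. ereal (\<integral>\<theta>. ?R M \<theta> \<partial>\<pi>)) \<le> (SUP \<theta> \<in> \<Theta>. ereal (?R M \<theta>))"
      using M by (rule INF_lower2[rotated])
  qed
qed

end
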